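(* Let $P$ be a permutation of the $n$ subsystems of $\mathcal{H}_n=\mathbb{C}^{d_1}\otimes\cdots\otimes\mathbb{C}^{d_n}$ (with $d_{P(i)}=d_i$ for all $i$), and let $E_{inv}$ be an SL-invariant multipartite measure of entanglement on $\mathcal{H}_n$ that is also invariant under $P$, i.e. $E_{inv}(V_P\rho V_P^\dagger)=E_{inv}(\rho)$ for all $\rho$. Let $\rho:\mathcal{H}_n\to\mathcal{H}_n$ be a mixed state (density matrix) with $E_{inv}(\rho)>0$, and assume that the entanglement of $\rho$ is $P$-symmetric. Then the permuted version of the state can be achieved by a product unitary operation: there exist unitaries $U_{A_i}$ on $\mathbb{C}^{d_i}$, $i=1,\dots,n$, such that $$V_P\,\rho\, V_P^\dagger=(U_{A_1}\otimes U_{A_2}\otimes\cdots\otimes U_{A_n})\,\rho\,(U_{A_1}\otimes U_{A_2}\otimes\cdots\otimes U_{A_n})^\dagger .$$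
   Context: Let $d_1,\dots,d_n$ be positive integers, $\mathcal{H}_n\equiv\mathbb{C}^{d_1}\otimes\cdots\otimes\mathbb{C}^{d_n}$, $\mathcal{B}(\mathcal{H}_n)$ the set of (bounded) linear operators on $\mathcal{H}_n$, and $G\equiv\mathrm{SL}(d_1,\mathbb{C})\otimes\cdots\otimes\mathrm{SL}(d_n,\mathbb{C})$, i.e. the group of operators $g_1\otimes\cdots\otimes g_n$ with each $g_i$ a $d_i\times d_i$ complex matrix of determinant $1$. SL-invariant multipartite measure of entanglement: a not identically zero function $E_{inv}:\mathcal{B}(\mathcal{H}_n)\to[0,\infty)$ such that: (i) $E_{inv}(g\rho g^\dagger)=E_{inv}(\rho)$ for all $g\in G$, $\rho\in\mathcal{B}(\mathcal{H}_n)$; (ii) $E_{inv}(r\rho)=rE_{inv}(\rho)$ for all real $r\ge 0$ and all $\rho\in\mathcal{B}(\mathcal{H}_n)$; (iii) on mixed states (density matrices) it is given by the convex roof: $E_{inv}(\rho)=\min\sum_i p_iE_{inv}(|\psi_i\rangle\langle\psi_i|)$, where the minimum (assumed attained) is over all finite pure-state decompositions $\rho=\sum_i p_i|\psi_i\rangle\langle\psi_i|$ with $p_i\ge 0$ and unit vectors $|\psi_i\rangle\in\mathcal{H}_n$. For a permutation $P$ of the $n$ parties, $V_P$ denotes the unitary operator on $\mathcal{H}_n$ that permutes the tensor factors according to $P$, and $V_P\rho V_P^\dagger$ is the permuted version of $\rho$. The entanglement of $\rho$ is $P$-symmetric if there is an LOCC map $\Lambda$ (a trace-preserving operation implementable deterministically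 by local operations of the $n$ parties and classical communication) with $\Lambda(\rho)=V_P\rho V_P^\dagger$. Every LOCC map is a trace-preserving separable operation: $\Lambda(\cdot)=\sum_kM_k(\cdot)M_k^\dagger$ (finite sum) with $M_k=A_1^{(k)}\otimes\cdots\otimes A_n^{(k)}$, $A_i^{(k)}$ acting on $\mathbb{C}^{d_i}$, and $\sum_kM_k^\dagger M_k=1$. *)

theory Defs
  imports "Jordan_Normal_Form.Schur_Decomposition" "HOL-Combinatorics.Permutations"
begin

(* The system is given by its list of local dimensions ds; party i < length ds holds
   C^(ds ! i).  The total space is C^(prod_list ds), whose standard basis vector number x is
   the product vector e_(x_0) (x) ... (x) e_(x_(n-1)), where x_0, ..., x_(n-1) are the mixed
   radix digits of x, most significant first, as for the Kronecker product. *)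

fun digits :: "nat list \<Rightarrow> nat \<Rightarrow> nat list" where
  "digits [] x = []"
| "digits (d # ds) x = (x div prod_list ds) # digits ds (x mod prod_list ds)"

definition tensor :: "complex mat list \<Rightarrow> complex mat" where
  "tensor As =
     mat (prod_list (map dim_row As)) (prod_list (map dim_col As))
       (\<lambda>(x, y). \<Prod>k<length As.
          (As ! k) $$ (digits (map dim_row As) x ! k, digits (map dim_col As) y ! k))"

(* perm_op ds P moves the tensor factor at position k to position P k:
   it sends e_(y_0) (x) ... (x) e_(y_(n-1)) to the e_(x_0) (x) ... (x) e_(x_(n-1)) with
   x_(P k) = y_k. *)

definition perm_op :: "nat list \<Rightarrow> (nat \<Rightarrow> nat) \<Rightarrow> complex mat" where
  "perm_op ds P =
     mat (prod_list ds) (prod_list ds)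
       (\<lambda>(x, y). if \<forall>k<length ds. digits ds x ! P k = digits ds y ! k then 1 else 0)"

definition msum :: "nat \<Rightarrow> nat \<Rightarrow> complex mat list \<Rightarrow> complex mat" where
  "msum nr nc As = foldr (+) As (0\<^sub>m nr nc)"

definition unitary_mat :: "nat \<Rightarrow> complex mat \<Rightarrow> bool" where
  "unitary_mat d U \<longleftrightarrow>
     U \<in> carrier_mat d d \<and> U * mat_adjoint U = 1\<^sub>m d \<and> mat_adjoint U * U = 1\<^sub>m d"

(* In the order on complex numbers used here, 0 <= z means that z is real and nonnegative. *)

definition density_mat :: "nat \<Rightarrow> complex mat \<Rightarrow> bool" where
  "density_mat D \<rho> \<longleftrightarrow>
     \<rho> \<in> carrier_mat D D \<and> mat_adjoint \<rho> = \<rho> \<and>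
     (\<forall>v\<in>carrier_vec D. 0 \<le> (\<rho> *\<^sub>v v) \<bullet>c v) \<and>
     (\<Sum>a<D. \<rho> $$ (a, a)) = 1"

definition ket_bra :: "complex vec \<Rightarrow> complex mat" where
  "ket_bra \<psi> = mat (dim_vec \<psi>) (dim_vec \<psi>) (\<lambda>(a, b). \<psi> $ a * cnj (\<psi> $ b))"

(* The weights p of a decomposition of a density matrix sum to 1, by taking traces. *)

definition pure_decomposition ::
    "nat \<Rightarrow> complex mat \<Rightarrow> (real \<times> complex vec) list \<Rightarrow> bool" where
  "pure_decomposition D \<rho> xs \<longleftrightarrow>
     (\<forall>(p, \<psi>)\<in>set xs. 0 \<le> p \<and> \<psi> \<in> carrier_vec D \<and> \<psi> \<bullet>c \<psi> = 1) \<and>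
     \<rho> = msum D D (map (\<lambda>(p, \<psi>). complex_of_real p \<cdot>\<^sub>m ket_bra \<psi>) xs)"

definition average_value ::
    "(complex mat \<Rightarrow> real) \<Rightarrow> (real \<times> complex vec) list \<Rightarrow> real" where
  "average_value E xs = (\<Sum>(p, \<psi>)\<leftarrow>xs. p * E (ket_bra \<psi>))"

definition SL_tensors :: "nat list \<Rightarrow> complex mat set" where
  "SL_tensors ds =
     {tensor gs | gs. length gs = length ds \<and>
        (\<forall>i<length ds. gs ! i \<in> carrier_mat (ds ! i) (ds ! i) \<and> det (gs ! i) = 1)}"

definition SL_invariant_measure :: "nat list \<Rightarrow> (complex mat \<Rightarrow> real) \<Rightarrow> bool" where
  "SL_invariant_measure ds E \<longleftrightarrow>
     (let D = prod_list ds; B = carrier_mat D D in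
       (\<forall>\<rho>\<in>B. 0 \<le> E \<rho>) \<and>
       (\<exists>\<rho>\<in>B. E \<rho> \<noteq> 0) \<and>
       (\<forall>g\<in>SL_tensors ds. \<forall>\<rho>\<in>B. E (g * \<rho> * mat_adjoint g) = E \<rho>) \<and>
       (\<forall>r\<ge>0. \<forall>\<rho>\<in>B. E (complex_of_real r \<cdot>\<^sub>m \<rho>) = r * E \<rho>) \<and>
       (\<forall>\<rho>. density_mat D \<rho> \<longrightarrow>
          (\<exists>xs. pure_decomposition D \<rho> xs \<and> E \<rho> = average_value E xs) \<and>
          (\<forall>xs. pure_decomposition D \<rho> xs \<longrightarrow> E \<rho> \<le> average_value E xs)))"

(* locc es ds Ks: Ks lists the overall Kraus operators of an LOCC protocol taking a system with
   local dimensions ds to one with local dimensions es, each Kraus operator being given by the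
   list of its tensor factors.  In each step one party i applies a complete set Bs of local Kraus
   operators and announces the outcome j, after which the parties continue with a protocol
   that may depend on j.  The dimension of the party's system may change (also depending on
   j), so attaching and discarding local ancillas is included. *)

inductive locc :: "nat list \<Rightarrow> nat list \<Rightarrow> complex mat list list \<Rightarrow> bool"
  for es :: "nat list" where
  locc_stop: "locc es es [map 1\<^sub>m es]"
| locc_step:
    "locc es ds
       (concat (map2 (\<lambda>B Ks. map (\<lambda>K. K[i := K ! i * B]) Ks) Bs Kss))"
  if "i < length ds"
    and "\<forall>B\<in>set Bs. dim_col B = ds ! i"
    and "msum (ds ! i) (ds ! i) (map (\<lambda>B. mat_adjoint B * B) Bs) = 1\<^sub>m (ds ! i)"
    and "length Kss = length Bs"
    and "\<forall>j<length Bs. locc es (ds[i := dim_row (Bs ! j)]) (Kss ! j)"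

definition locc_map :: "nat list \<Rightarrow> (complex mat \<Rightarrow> complex mat) \<Rightarrow> bool" where
  "locc_map ds \<Lambda> \<longleftrightarrow>
     (\<exists>Ks. locc ds ds Ks \<and>
        (\<forall>\<rho>\<in>carrier_mat (prod_list ds) (prod_list ds).
           \<Lambda> \<rho> = msum (prod_list ds) (prod_list ds)
                    (map (\<lambda>K. tensor K * \<rho> * mat_adjoint (tensor K)) Ks)))"

definition entanglement_P_symmetric ::
    "nat list \<Rightarrow> (nat \<Rightarrow> nat) \<Rightarrow> complex mat \<Rightarrow> bool" where
  "entanglement_P_symmetric ds P \<rho> \<longleftrightarrow>
     (\<exists>\<Lambda>. locc_map ds \<Lambda> \<and> \<Lambda> \<rho> = perm_op ds P * \<rho> * mat_adjoint (perm_op ds P))"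

end

theory Submission
  imports Defs
begin

text \<open>Write a Kraus operator of the protocol as \<open>M = A\<^sub>1 \<otimes> \<dots> \<otimes> A\<^sub>n\<close> and let
  \<open>q M = (\<Prod>i. \<bar>det A\<^sub>i\<bar> powr (2 / d\<^sub>i))\<close>. Invariance and homogeneity give \<open>E (M X M\<^sup>*) = q M * E X\<close>, so applying
  all Kraus operators to an optimal pure decomposition of \<open>\<rho>\<close> yields
  \<open>E \<rho> = E (\<Lambda> \<rho>) \<le> (\<Sum>M. q M) * E \<rho>\<close>. By the inequality of arithmetic and geometric means for the
  eigenvalues of \<open>A\<^sub>i\<^sup>* A\<^sub>i\<close>, \<open>q M \<le> (\<Prod>i. tr (A\<^sub>i\<^sup>* A\<^sub>i) / d\<^sub>i)\<close>, and these bounds sum to \<open>1\<close> by trace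
  preservation. Hence equality holds throughout, every \<open>A\<^sub>i\<close> in a nonzero Kraus
  operator is a multiple of a unitary, and \<open>V \<rho> V\<^sup>*\<close> is a convex combination of product unitary conjugates of \<open>\<rho>\<close>. All of these matrices
  have the same Hilbert--Schmidt norm, so strict convexity makes \<open>V \<rho> V\<^sup>*\<close> one of them.\<close>

section \<open>Adjoint, trace and Frobenius norm\<close>

text \<open>The weight \<open>q M\<close> has its form because of the group: dividing a nonsingular
  factor by a \<open>d\<close>-th root of its determinant puts it into SL, and homogeneity turns the
  scalar split off into a power of the modulus of the determinant. The convex roof bounds the value
  at the permuted state only from above. This suffices because \<open>E\<close> takes the same
  positive value at both states: it cancels, and \<open>1\<close> becomes a lower bound for a sum
  that is also at most \<open>1\<close>. Two obstacles shape the details. Singular factors are not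
  multiples of SL matrices, and \<open>E\<close> is not assumed continuous, so they need an argument
  of their own. A protocol may change local dimensions midway, so the Kraus factors of its later
  rounds can be rectangular; trace preservation is therefore proved by induction over the rounds,
  directly for products of local traces instead of traces on the total space.\<close>

lemma index_mult_mat_sum:
  assumes "i < dim_row A" "j < dim_col B" "dim_col A = dim_row B"
  shows "(A * B) $$ (i, j) = (\<Sum>k<dim_row B. A $$ (i, k) * B $$ (k, j))"
  using assms by (simp add: scalar_prod_def atLeast0LessThan)

lemma dim_mat_adjoint [simp]:
  "dim_row (mat_adjoint A) = dim_col A" "dim_col (mat_adjoint A) = dim_row A"
  by (simp_all add: mat_adjoint_def)

lemma mat_adjoint_carrier [simp]: "A \<in> carrier_mat m n \<Longrightarrow> mat_adjoint A \<in> carrier_mat n m"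
  by (metis carrier_matD carrier_matI dim_mat_adjoint)

lemma index_mat_adjoint [simp]:
  fixes A :: "complex mat"
  shows "i < dim_col A \<Longrightarrow> j < dim_row A \<Longrightarrow> mat_adjoint A $$ (i, j) = cnj (A $$ (j, i))"
  by (simp add: mat_adjoint_def mat_of_rows_index)

lemma mat_adjoint_mat_adjoint [simp]:
  fixes A :: "complex mat"
  shows "mat_adjoint (mat_adjoint A) = A"
  by (rule eq_matI) auto

lemma mat_adjoint_mult:
  fixes A B :: "complex mat"
  assumes "dim_col A = dim_row B"
  shows "mat_adjoint (A * B) = mat_adjoint B * mat_adjoint A"
  using assms by (intro eq_matI) (simp_all add: index_mult_mat_sum mult.commute del: index_mult_mat(1))

lemma mat_adjoint_smult [simp]:
  fixes A :: "complex mat"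
  shows "mat_adjoint (c \<cdot>\<^sub>m A) = cnj c \<cdot>\<^sub>m mat_adjoint A"
  by (rule eq_matI) auto

lemma mat_adjoint_one [simp]: "mat_adjoint (1\<^sub>m n) = (1\<^sub>m n :: complex mat)"
  by (rule eq_matI) auto

definition trace :: "complex mat \<Rightarrow> complex" where
  "trace A = (\<Sum>i<dim_row A. A $$ (i, i))"

lemma trace_mult_eq_sum:
  assumes "A \<in> carrier_mat m n" "B \<in> carrier_mat n m"
  shows "trace (A * B) = (\<Sum>i<m. \<Sum>k<n. A $$ (i, k) * B $$ (k, i))"
  using assms by (simp add: trace_def index_mult_mat_sum del: index_mult_mat(1))

lemma trace_mult_commute:
  assumes "A \<in> carrier_mat m n" "B \<in> carrier_mat n m"
  shows "trace (A * B) = trace (B * A)"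
  unfolding trace_mult_eq_sum[OF assms] trace_mult_eq_sum[OF assms(2,1)]
  by (subst sum.swap) (simp add: mult.commute)

lemma trace_one [simp]: "trace (1\<^sub>m n) = of_nat n"
  by (simp add: trace_def)

lemma trace_smult: "trace (c \<cdot>\<^sub>m A) = c * trace A" if "A \<in> carrier_mat n n"
  using that by (simp add: trace_def sum_distrib_left)

lemma trace_add:
  assumes "A \<in> carrier_mat n n" "B \<in> carrier_mat n n"
  shows "trace (A + B) = trace A + trace B"
  using assms by (simp add: trace_def sum.distrib)

section \<open>Sums of lists of matrices\<close>

lemma msum_simps [simp]:
  "msum m n [] = 0\<^sub>m m n" "msum m n (A # As) = A + msum m n As"
  by (simp_all add: msum_def)

lemma msum_carrier:
  "\<forall>A\<in>set As. A \<in> carrier_mat m n \<Longrightarrow> msum m n As \<in> carrier_mat m n"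
  by (induction As) auto

lemma msum_append:
  assumes "\<forall>A\<in>set As. A \<in> carrier_mat m n" "\<forall>A\<in>set Bs. A \<in> carrier_mat m n"
  shows "msum m n (As @ Bs) = msum m n As + msum m n Bs"
  using assms(1) by (induction As) (use msum_carrier[OF assms(2)] msum_carrier[of _ m n] in \<open>auto intro!: assoc_add_mat[symmetric]\<close>)

lemma trace_mult_msum:
  assumes "X \<in> carrier_mat n m" "\<forall>A\<in>set As. A \<in> carrier_mat m n"
  shows "trace (X * msum m n As) = (\<Sum>A\<leftarrow>As. trace (X * A))"
  using assms(2)
proof (induction As)
  case Nil
  with assms(1) show ?case by (simp add: trace_def)
next
  case (Cons A As)
  have "trace (X * msum m n (A # As)) = trace (X * A + X * msum m n As)"
    using Cons.prems assms(1) msum_carrier[of As m n]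
    by (simp add: mult_add_distrib_mat[of X n m A n])
  also have "\<dots> = trace (X * A) + trace (X * msum m n As)"
    by (rule trace_add[where n = n]) (use Cons.prems assms(1) msum_carrier[of As m n] in auto)
  finally show ?case using Cons by simp
qed

lemma mult_msum:
  assumes "X \<in> carrier_mat l m" "Y \<in> carrier_mat n p" "\<forall>A\<in>set As. A \<in> carrier_mat m n"
  shows "X * msum m n As * Y = msum l p (map (\<lambda>A. X * A * Y) As)"
  using assms(3)
proof (induction As)
  case Nil
  then show ?case using assms by simp
next
  case (Cons A As)
  have "X * (A + msum m n As) * Y = (X * A + X * msum m n As) * Y"
    using Cons.prems assms msum_carrier[of As m n] by (subst mult_add_distrib_mat) auto
  also have "\<dots> = X * A * Y + X * msum m n As * Y"
    using Cons.prems assms msum_carrier[of As m n]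
    by (intro add_mult_distrib_mat) auto
  finally show ?case using Cons by simp
qed

text \<open>The square of the Hilbert-Schmidt norm. Without the root it equals the trace of
  \<open>mat_adjoint A * A\<close>, hence the sum of the eigenvalues of that matrix.\<close>

definition frob :: "complex mat \<Rightarrow> real" where
  "frob A = (\<Sum>i<dim_row A. \<Sum>j<dim_col A. (cmod (A $$ (i, j)))\<^sup>2)"

lemma frob_nonneg [simp]: "0 \<le> frob A"
  unfolding frob_def by (intro sum_nonneg) simp

lemma frob_eq_0D:
  assumes "frob A = 0" "A \<in> carrier_mat m n"
  shows "A = 0\<^sub>m m n"
proof (rule eq_matI)
  fix i j assume ij: "i < dim_row (0\<^sub>m m n)" "j < dim_col (0\<^sub>m m n)"
  have "(\<Sum>j<dim_col A. (cmod (A $$ (i, j)))\<^sup>2) = 0"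
    using assms ij unfolding frob_def by (subst (asm) sum_nonneg_eq_0_iff) (auto intro: sum_nonneg)
  then show "A $$ (i, j) = 0\<^sub>m m n $$ (i, j)"
    using ij assms(2) by (subst (asm) sum_nonneg_eq_0_iff) auto
qed (use assms in auto)

lemma trace_mult_adjoint: "trace (A * mat_adjoint A) = of_real (frob A)"
proof -
  have "trace (A * mat_adjoint A)
      = (\<Sum>i<dim_row A. \<Sum>k<dim_col A. A $$ (i, k) * mat_adjoint A $$ (k, i))"
    by (rule trace_mult_eq_sum) auto
  then show ?thesis by (simp add: frob_def complex_norm_square[symmetric])
qed

lemma trace_adjoint_mult: "trace (mat_adjoint A * A) = of_real (frob A)"
  unfolding trace_mult_adjoint[symmetric]
  by (rule trace_mult_commute[where m = "dim_col A" and n = "dim_row A"]) auto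

text \<open>For positive entries, \<open>ln t \<le> t - 1\<close> at \<open>t = x i / m\<close> is
  summed over \<open>i\<close>; the right-hand sides add up to \<open>0\<close>. Equality there
  holds only for \<open>t = 1\<close>, which settles the equality case that later forces unitarity.
  A vanishing entry has no logarithm and is treated apart: equality then means \<open>m = 0\<close>,
  so all entries vanish.\<close>

lemma arith_geo_mean_prod:
  fixes x :: "nat \<Rightarrow> real"
  assumes n: "0 < n" and x: "\<And>i. i < n \<Longrightarrow> 0 \<le> x i"
  defines "m \<equiv> (\<Sum>i<n. x i) / n"
  shows "(\<Prod>i<n. x i) \<le> m ^ n"
    and "(\<Prod>i<n. x i) = m ^ n \<Longrightarrow> i < n \<Longrightarrow> x i = m"
proof -
  have m0: "0 \<le> m" unfolding m_def using x by (intro divide_nonneg_nonneg sum_nonneg) auto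
  have "(\<Prod>i<n. x i) \<le> m ^ n \<and> ((\<Prod>i<n. x i) = m ^ n \<longrightarrow> (\<forall>i<n. x i = m))"
  proof (cases "\<exists>i<n. x i = 0")
    case True
    then have p: "(\<Prod>i<n. x i) = 0" by (metis finite_lessThan lessThan_iff prod_zero)
    moreover have "x i = m" if "m = 0" "i < n" for i
    proof -
      have "sum x {..<n} = 0" using that(1) n by (simp add: m_def)
      then show ?thesis using that x by (subst (asm) sum_nonneg_eq_0_iff) auto
    qed
    ultimately show ?thesis using m0 n unfolding p by simp
  next
    case False
    then have pos: "0 < x i" if "i < n" for i using x[OF that] that by (force simp: less_le)
    have "0 < (\<Sum>i<n. x i)" using n pos by (intro sum_pos) auto
    then have m: "0 < m" unfolding m_def using n by simp
    have mean: "(\<Sum>i<n. x i / m - 1) = 0"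
      using n \<open>0 < (\<Sum>i<n. x i)\<close> by (simp add: sum_subtractf flip: sum_divide_distrib) (simp add: m_def)
    have ln_le: "ln (x i / m) \<le> x i / m - 1" if "i < n" for i
      using pos[OF that] m by (intro ln_le_minus_one) simp
    have lnp: "ln ((\<Prod>i<n. x i) / m ^ n) = (\<Sum>i<n. ln (x i / m))"
    proof -
      have "(\<Prod>i<n. x i) / m ^ n = (\<Prod>i<n. x i / m)" by (simp add: prod_dividef)
      also have "ln \<dots> = (\<Sum>i<n. ln (x i / m))" using pos m by (intro ln_prod) force+
      finally show ?thesis .
    qed
    have pp: "0 < (\<Prod>i<n. x i)" using pos by (intro prod_pos) auto
    have "ln ((\<Prod>i<n. x i) / m ^ n) \<le> 0"
      unfolding lnp mean[symmetric] using ln_le by (intro sum_mono) auto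
    then have "(\<Prod>i<n. x i) \<le> m ^ n" using pp m by (simp add: ln_le_zero_iff)
    moreover have "x i = m" if "(\<Prod>i<n. x i) = m ^ n" "i < n" for i
    proof -
      have "(\<Sum>i<n. (x i / m - 1) - ln (x i / m)) = 0"
        using lnp that(1) mean m by (simp add: sum_subtractf)
      then have "(x i / m - 1) - ln (x i / m) = 0"
        using ln_le that(2) by (subst (asm) sum_nonneg_eq_0_iff) auto
      then have "x i / m = 1" using pos[OF that(2)] m by (intro ln_eq_minus_one) auto
      then show ?thesis using m by simp
    qed
    ultimately show ?thesis by blast
  qed
  then show "(\<Prod>i<n. x i) \<le> m ^ n" "(\<Prod>i<n. x i) = m ^ n \<Longrightarrow> i < n \<Longrightarrow> x i = m" by blast+
qed

section \<open>Determinant and Frobenius norm\<close>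

lemma adjoint_mult_self_quadratic:
  fixes A :: "complex mat" and v :: "complex vec"
  assumes "A \<in> carrier_mat m n" "v \<in> carrier_vec n"
  shows "(mat_adjoint A * A *\<^sub>v v) \<bullet>c v = (A *\<^sub>v v) \<bullet>c (A *\<^sub>v v)"
proof -
  have "(mat_adjoint A * A *\<^sub>v v) \<bullet>c v
      = (\<Sum>i<n. (\<Sum>k<m. cnj (A $$ (k, i)) * (A *\<^sub>v v) $ k) * cnj (v $ i))"
    using assms by (simp add: scalar_prod_def atLeast0LessThan assoc_mult_mat_vec[of _ n m _ n])
  also have "\<dots> = (\<Sum>k<m. (A *\<^sub>v v) $ k * cnj (\<Sum>i<n. A $$ (k, i) * v $ i))"
    unfolding sum_distrib_left sum_distrib_right cnj_sum
    by (subst sum.swap) (simp add: mult_ac)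
  also have "\<dots> = (A *\<^sub>v v) \<bullet>c (A *\<^sub>v v)"
    using assms by (simp add: scalar_prod_def atLeast0LessThan)
  finally show ?thesis .
qed

text \<open>Pairing the eigenvector equation with the eigenvector \<open>v\<close> expresses
  \<open>e\<close> as the squared norm of \<open>A *\<^sub>v v\<close> divided by that of
  \<open>v\<close>.\<close>

lemma eigenvalue_adjoint_mult_self:
  fixes A :: "complex mat"
  assumes A: "A \<in> carrier_mat m n" and e: "eigenvalue (mat_adjoint A * A) e"
  shows "e = of_real (Re e)" "0 \<le> Re e"
proof -
  obtain v where v: "v \<in> carrier_vec n" "v \<noteq> 0\<^sub>v n" and ev: "mat_adjoint A * A *\<^sub>v v = e \<cdot>\<^sub>v v"
    using e A unfolding eigenvalue_def eigenvector_def by auto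
  have pos: "0 < v \<bullet>c v" using v by (simp add: conjugate_square_greater_0_vec)
  have "e * (v \<bullet>c v) = (A *\<^sub>v v) \<bullet>c (A *\<^sub>v v)"
    using adjoint_mult_self_quadratic[OF A v(1)] v unfolding ev by simp
  also have "\<dots> \<ge> 0" by (rule conjugate_square_ge_0_vec)
  finally have ge: "0 \<le> e * (v \<bullet>c v)" .
  have vr: "v \<bullet>c v = of_real (Re (v \<bullet>c v))" "0 < Re (v \<bullet>c v)"
    using pos by (auto simp: less_complex_def complex_eq_iff)
  then obtain r where r: "v \<bullet>c v = of_real r" "0 < r" by blast
  show "e = of_real (Re e)" "0 \<le> Re e"
    using ge r unfolding r(1) by (auto simp: less_eq_complex_def complex_eq_iff zero_le_mult_iff)
qed

lemma upper_triangular_square_diag: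
  fixes T :: "complex mat"
  assumes T: "T \<in> carrier_mat n n" "upper_triangular T" and i: "i < n"
  shows "(T * T) $$ (i, i) = (T $$ (i, i))\<^sup>2"
proof -
  have "(T * T) $$ (i, i) = (\<Sum>k<n. T $$ (i, k) * T $$ (k, i))"
    using T i by (simp add: index_mult_mat_sum del: index_mult_mat(1))
  also have "\<dots> = (\<Sum>k<n. if k = i then T $$ (i, i) * T $$ (i, i) else 0)"
  proof (rule sum.cong)
    fix k assume "k \<in> {..<n}"
    then show "T $$ (i, k) * T $$ (k, i) = (if k = i then T $$ (i, i) * T $$ (i, i) else 0)"
      using T i by (cases k i rule: linorder_cases) (auto simp: upper_triangular_def)
  qed simp
  also have "\<dots> = (T $$ (i, i))\<^sup>2" using i by (simp add: power2_eq_square)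
  finally show ?thesis .
qed

lemma trace_similar:
  assumes "A \<in> carrier_mat n n" "similar_mat_wit A B P Q"
  shows "trace A = trace B"
proof -
  note w = similar_mat_witD2[OF assms]
  have "trace A = trace (P * B * Q)" by (simp flip: w(3))
  also have "\<dots> = trace (Q * (P * B))"
    by (rule trace_mult_commute[where m = n and n = n]) (use w in auto)
  also have "Q * (P * B) = (Q * P) * B"
    by (rule assoc_mult_mat[symmetric, where n\<^sub>1 = n and n\<^sub>2 = n and n\<^sub>3 = n and n\<^sub>4 = n]) (use w in auto)
  also have "\<dots> = B" using w by simp
  finally show ?thesis .
qed

lemma det_adjoint: "det (mat_adjoint A) = cnj (det A)" if A: "A \<in> carrier_mat n n" for A :: "complex mat"
proof -
  have "mat_adjoint A = transpose_mat (map_mat cnj A)"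
    using A by (intro eq_matI) auto
  moreover have "det (map_mat cnj A) = cnj (det A)"
  proof -
    interpret comm_ring_hom cnj by unfold_locales auto
    show ?thesis by (rule hom_det)
  qed
  ultimately show ?thesis using A det_transpose[of "map_mat cnj A" n] by simp
qed

text \<open>The numbers \<open>e i\<close> are the diagonal entries of a triangular matrix similar
  to \<open>H = mat_adjoint A * A\<close>. All quantities wanted are a determinant or traces, which
  similarity preserves, so triangular form is enough and no orthonormal eigenbasis is required. The
  sum of squares is what later detects that \<open>H\<close> is scalar.\<close>

lemma adjoint_mult_self_spectrum:
  fixes A :: "complex mat"
  assumes A: "A \<in> carrier_mat n n"
  obtains e :: "nat \<Rightarrow> real" where
    "\<And>i. i < n \<Longrightarrow> 0 \<le> e i" "(cmod (det A))\<^sup>2 = (\<Prod>i<n. e i)"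
    "frob A = (\<Sum>i<n. e i)" "frob (mat_adjoint A * A) = (\<Sum>i<n. (e i)\<^sup>2)"
proof -
  define H where "H = mat_adjoint A * A"
  have H: "H \<in> carrier_mat n n"
    unfolding H_def using mat_adjoint_carrier[OF A] A by (rule mult_carrier_mat)
  obtain es where es: "char_poly H = (\<Prod>a\<leftarrow>es. [:- a, 1:])"
    using char_poly_factorized[OF H] by blast
  obtain T where T: "T \<in> carrier_mat n n" "upper_triangular T" and sim: "similar_mat H T"
    using schur_decomposition_exists[OF H es] by blast
  obtain P Q where w: "similar_mat_wit H T P Q" using sim unfolding similar_mat_def by blast
  define e where "e i = Re (T $$ (i, i))" for i
  \<comment> \<open>The diagonal entries of \<open>T\<close> are the roots of its characteristic
    polynomial, which is also that of \<open>H\<close>.\<close>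
  have eig: "eigenvalue H (T $$ (i, i))" if "i < n" for i
  proof -
    have "poly (char_poly T) (T $$ (i, i)) = 0"
      unfolding char_poly_upper_triangular[OF T] using that T
      by (auto simp: poly_prod_list diag_mat_def prod_list_zero_iff)
    then show ?thesis
      using eigenvalue_root_char_poly[OF H] char_poly_similar[OF sim] by simp
  qed
  have Tii: "T $$ (i, i) = of_real (e i)" "0 \<le> e i" if "i < n" for i
    using eigenvalue_adjoint_mult_self[OF A eig[OF that, unfolded H_def]]
    unfolding e_def by auto
  show thesis
  proof (rule that[of e])
    show "0 \<le> e i" if "i < n" for i using Tii that by blast
    have "complex_of_real ((cmod (det A))\<^sup>2) = det H"
      unfolding H_def using A by (simp add: det_mult[of _ n] det_adjoint complex_norm_square mult.commute del: of_real_power)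
    also have "\<dots> = prod_list (diag_mat T)"
      using det_similar[OF sim] det_upper_triangular[OF T(2,1)] by simp
    also have "\<dots> = (\<Prod>i<n. T $$ (i, i))"
      using T by (simp add: diag_mat_def prod.list_conv_set_nth atLeast0LessThan)
    also have "\<dots> = of_real (\<Prod>i<n. e i)" using Tii by simp
    finally show "(cmod (det A))\<^sup>2 = (\<Prod>i<n. e i)" using of_real_eq_iff by blast
    have "complex_of_real (frob A) = trace T"
      using trace_similar[OF H w] trace_adjoint_mult[of A] unfolding H_def by simp
    also have "\<dots> = of_real (\<Sum>i<n. e i)" using Tii T by (simp add: trace_def)
    finally show "frob A = (\<Sum>i<n. e i)" using of_real_eq_iff by blast
    note W = similar_mat_witD2[OF H w]
    \<comment> \<open>Squaring keeps the same witnesses, since \<open>Q * P\<close> cancels in the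
      middle. As \<open>H\<close> is self-adjoint, \<open>frob H\<close> is the trace of
      \<open>H * H\<close>, which can now be read off the diagonal of \<open>T * T\<close>.\<close>
    have HH: "similar_mat_wit (H * H) (T * T) P Q"
    proof -
      have "H * H = P * (T * T) * Q"
      proof -
        have "H * H = (P * T * Q) * (P * T * Q)" by (simp flip: W(3))
        also have "\<dots> = P * T * (Q * P) * (T * Q)"
          using W(4-7) by (simp add: assoc_mult_mat[where n\<^sub>1 = n and n\<^sub>2 = n and n\<^sub>3 = n and n\<^sub>4 = n])
        also have "\<dots> = P * (T * T) * Q"
          unfolding W(2) using W(4-7) by (simp add: assoc_mult_mat[where n\<^sub>1 = n and n\<^sub>2 = n and n\<^sub>3 = n and n\<^sub>4 = n])
        finally show ?thesis .
      qed
      then show ?thesis using W H T unfolding similar_mat_wit_def Let_def by auto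
    qed
    have "mat_adjoint H = H" unfolding H_def using A by (simp add: mat_adjoint_mult)
    then have "complex_of_real (frob H) = trace (H * H)"
      using trace_adjoint_mult[of H] by simp
    also have "\<dots> = trace (T * T)" by (rule trace_similar[OF mult_carrier_mat[OF H H] HH])
    also have "\<dots> = (\<Sum>i<n. (T $$ (i, i))\<^sup>2)"
      unfolding trace_def using T upper_triangular_square_diag[OF T] by (simp del: index_mult_mat(1))
    also have "\<dots> = of_real (\<Sum>i<n. (e i)\<^sup>2)" using Tii by simp
    finally show "frob (mat_adjoint A * A) = (\<Sum>i<n. (e i)\<^sup>2)"
      unfolding H_def using of_real_eq_iff by blast
  qed
qed

text \<open>The geometric mean of the eigenvalues of \<open>mat_adjoint A * A\<close>, and the
  contribution of one tensor factor to \<open>q M\<close>. It is \<open>0\<close> for singular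
  \<open>A\<close>.\<close>

definition det_scale :: "complex mat \<Rightarrow> real" where
  "det_scale A = root (dim_row A) ((cmod (det A))\<^sup>2)"

lemma det_scale_nonneg [simp]: "0 \<le> det_scale A"
  by (simp add: det_scale_def real_root_ge_zero)

lemma det_scale_le_frob:
  assumes A: "A \<in> carrier_mat n n" and n: "0 < n"
  shows "det_scale A \<le> frob A / n"
proof -
  obtain e where e: "\<And>i. i < n \<Longrightarrow> 0 \<le> e i" "(cmod (det A))\<^sup>2 = (\<Prod>i<n. e i)"
    "frob A = (\<Sum>i<n. e i)" by (rule adjoint_mult_self_spectrum[OF A]) blast
  have "det_scale A ^ n = (\<Prod>i<n. e i)"
    using A n e(2)[symmetric] by (simp add: det_scale_def)
  also have "\<dots> \<le> (frob A / n) ^ n" unfolding e(3) by (rule arith_geo_mean_prod(1)[OF n e(1)])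
  finally show ?thesis using n frob_nonneg[of A] by (simp add: power_mono_iff)
qed

text \<open>Equality of the means makes every eigenvalue of \<open>H = mat_adjoint A * A\<close>
  equal to \<open>c\<close>. That \<open>H\<close> is then scalar follows without diagonalization:
  \<open>Z\<close>, the difference of \<open>H\<close> and \<open>c\<close> times the identity, is
  self-adjoint, so \<open>frob Z\<close> is the trace of \<open>Z * Z\<close>, which is
  \<open>n * c\<^sup>2 - 2 * c * (n * c) + n * c\<^sup>2 = 0\<close>.\<close>

lemma det_scale_eq_frobD:
  assumes A: "A \<in> carrier_mat n n" and n: "0 < n" and eq: "det_scale A = frob A / n"
  shows "mat_adjoint A * A = of_real (det_scale A) \<cdot>\<^sub>m 1\<^sub>m n"
proof -
  obtain e where e: "\<And>i. i < n \<Longrightarrow> 0 \<le> e i" "(cmod (det A))\<^sup>2 = (\<Prod>i<n. e i)"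
    "frob A = (\<Sum>i<n. e i)" "frob (mat_adjoint A * A) = (\<Sum>i<n. (e i)\<^sup>2)"
    by (rule adjoint_mult_self_spectrum[OF A]) blast
  define c where "c = det_scale A"
  have "(\<Prod>i<n. e i) = ((\<Sum>i<n. e i) / n) ^ n"
    using A n e(2)[symmetric] unfolding e(3)[symmetric] eq[symmetric] by (simp add: det_scale_def)
  then have ei: "e i = c" if "i < n" for i
    using arith_geo_mean_prod(2)[OF n e(1) _ that] eq e(3) unfolding c_def by simp
  define H where "H = mat_adjoint A * A"
  have H: "H \<in> carrier_mat n n"
    unfolding H_def using mat_adjoint_carrier[OF A] A by (rule mult_carrier_mat)
  have adj: "mat_adjoint H = H"
    unfolding H_def using A by (simp add: mat_adjoint_mult)
  have trH: "trace H = of_real (n * c)"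
    unfolding H_def trace_adjoint_mult e(3) using ei by simp
  have trHH: "trace (H * H) = of_real (n * c\<^sup>2)"
    using trace_adjoint_mult[of H] e(4) ei unfolding adj by (simp flip: H_def)
  define Z where "Z = H - of_real c \<cdot>\<^sub>m 1\<^sub>m n"
  have Z: "Z \<in> carrier_mat n n" unfolding Z_def by (intro minus_carrier_mat) simp
  have "mat_adjoint Z = Z"
  proof (rule eq_matI)
    fix i j assume ij: "i < dim_row Z" "j < dim_col Z"
    have "cnj (H $$ (j, i)) = H $$ (i, j)"
      using ij Z H index_mat_adjoint[of i H j] unfolding adj by simp
    then show "mat_adjoint Z $$ (i, j) = Z $$ (i, j)" using ij Z H by (auto simp: Z_def)
  qed (use Z in auto)
  then have "of_real (frob Z) = trace (Z * Z)" using trace_adjoint_mult[of Z] by simp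
  also have "\<dots> = (\<Sum>i<n. \<Sum>k<n. Z $$ (i, k) * Z $$ (k, i))" by (rule trace_mult_eq_sum[OF Z Z])
  also have "\<dots> = (\<Sum>i<n. \<Sum>k<n. H $$ (i, k) * H $$ (k, i)
      - (if k = i then 2 * of_real c * H $$ (i, i) - (of_real c)\<^sup>2 else 0))"
    using H by (intro sum.cong) (auto simp: Z_def power2_eq_square algebra_simps)
  also have "\<dots> = trace (H * H) - 2 * of_real c * trace H + of_nat n * (of_real c)\<^sup>2"
    unfolding trace_mult_eq_sum[OF H H] using H
    by (simp add: sum_subtractf trace_def sum_distrib_left)
  also have "\<dots> = 0" unfolding trH trHH by (simp add: power2_eq_square algebra_simps)
  finally have "frob Z = 0" by simp
  from frob_eq_0D[OF this Z] have Z0: "Z = 0\<^sub>m n n" .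
  show ?thesis unfolding H_def[symmetric] c_def[symmetric]
  proof (rule eq_matI)
    fix i j assume ij: "i < dim_row (complex_of_real c \<cdot>\<^sub>m 1\<^sub>m n)" "j < dim_col (complex_of_real c \<cdot>\<^sub>m 1\<^sub>m n)"
    then have "Z $$ (i, j) = 0" using Z0 by simp
    then show "H $$ (i, j) = (complex_of_real c \<cdot>\<^sub>m 1\<^sub>m n) $$ (i, j)"
      using ij H by (simp add: Z_def)
  qed (use H in auto)
qed

lemma nonsingular_eq_smult_SL:
  assumes A: "A \<in> carrier_mat n n" and n: "0 < n" and d: "det A \<noteq> 0"
  obtains z g where "g \<in> carrier_mat n n" "det g = 1" "A = z \<cdot>\<^sub>m g" "(cmod z)\<^sup>2 = det_scale A"
proof -
  \<comment> \<open>An \<open>n\<close>-th root of the determinant in polar form. Any other choice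
    would do, since only the modulus of \<open>z\<close> enters the conclusion.\<close>
  define z where "z = rcis (root n (cmod (det A))) (Arg (det A) / n)"
  have zn: "z ^ n = det A"
    unfolding z_def DeMoivre2 using n by (simp add: rcis_cmod_Arg)
  then have z0: "z \<noteq> 0" using d n by (auto simp: zero_power)
  define g where "g = inverse z \<cdot>\<^sub>m A"
  show thesis
  proof (rule that)
    show "g \<in> carrier_mat n n" using A by (simp add: g_def)
    show "det g = 1" unfolding g_def using A d z0
      by (simp add: det_smult power_inverse zn)
    show "A = z \<cdot>\<^sub>m g" unfolding g_def using A z0 by (intro eq_matI) auto
    have "(cmod z)\<^sup>2 ^ n = (cmod (det A))\<^sup>2"
      unfolding zn[symmetric] norm_power by (simp add: power_mult[symmetric] mult.commute)
    then show "(cmod z)\<^sup>2 = det_scale A"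
      unfolding det_scale_def using A n by (metis carrier_matD(1) real_root_power_cancel zero_le_power2)
  qed
qed

text \<open>The range of a singular matrix lies in a proper subspace, which an SL matrix may stretch
  at the expense of a complementary direction.\<close>

lemma singular_SL_double:
  assumes A: "A \<in> carrier_mat n n" and d: "det A = 0"
  obtains g :: "complex mat" where "g \<in> carrier_mat n n" "det g = 1" "g * A = 2 \<cdot>\<^sub>m A"
proof -
  \<comment> \<open>Elimination acts on a pair of matrices; the second one has no columns because
    only the echelon form \<open>R\<close> of \<open>A\<close> and the invertible \<open>P\<close>
    with \<open>R = P * A\<close> are wanted.\<close>
  obtain R where R: "gauss_jordan A (0\<^sub>m n 0) = (R, snd (gauss_jordan A (0\<^sub>m n 0)))"
    by (metis prod.collapse)
  have Z: "0\<^sub>m n 0 \<in> carrier_mat n 0" by simp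
  obtain P where PU: "P \<in> Units (ring_mat TYPE(complex) n ())" and RP: "R = P * A"
    using gauss_jordan_transform[OF A Z R, of "()"] by blast
  obtain Q where P: "P \<in> carrier_mat n n" and Q: "Q \<in> carrier_mat n n"
    and QP: "Q * P = 1\<^sub>m n" and PQ: "P * Q = 1\<^sub>m n"
    using PU unfolding Units_def by (auto simp: ring_mat_simps)
  have Rc: "R \<in> carrier_mat n n" using RP P A by simp
  have detPQ: "det P * det Q = 1" using det_mult[OF P Q] PQ by simp
  have "R \<noteq> 1\<^sub>m n"
  proof
    assume "R = 1\<^sub>m n"
    then have "det P * det A = 1" using det_mult[OF P A] RP by simp
    then show False using d by simp
  qed
  \<comment> \<open>A square reduced echelon form other than the identity ends in a zero
    row.\<close>
  then have n: "0 < n" and row: "row R (n - 1) = 0\<^sub>v n"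
    using row_echelon_form_imp_1_or_0_row[OF Rc gauss_jordan_row_echelon[OF A R]] by auto
  \<comment> \<open>All rows are doubled except the last, whose entry
    \<open>inverse (2 ^ (n - 1))\<close> restores determinant \<open>1\<close>. On \<open>R\<close>
    this compensation is invisible, because the last row of \<open>R\<close> vanishes.\<close>
  define D :: "complex mat" where
    "D = mat n n (\<lambda>(i, j). if i = j then (if i = n - 1 then inverse (2 ^ (n - 1)) else 2) else 0)"
  have D: "D \<in> carrier_mat n n" by (simp add: D_def)
  have detD: "det D = 1"
  proof -
    have "det D = prod_list (diag_mat D)"
      by (rule det_upper_triangular[OF _ D]) (auto simp: D_def)
    also have "\<dots> = (\<Prod>i<n. if i = n - 1 then inverse (2 ^ (n - 1)) else 2)"
      by (simp add: diag_mat_def prod.list_conv_set_nth atLeast0LessThan D_def)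
    also have "{..<n} = insert (n - 1) {..<n - 1}" using n by auto
    also have "(\<Prod>i\<in>insert (n - 1) {..<n - 1}. if i = n - 1 then inverse (2 ^ (n - 1)) else 2)
        = (1 :: complex)" by (subst prod.insert) auto
    finally show ?thesis .
  qed
  have DR: "D * R = 2 \<cdot>\<^sub>m R"
  proof (rule eq_matI)
    fix i j assume "i < dim_row (2 \<cdot>\<^sub>m R)" "j < dim_col (2 \<cdot>\<^sub>m R)"
    then have ij: "i < n" "j < n" using Rc by auto
    have "(D * R) $$ (i, j) = (\<Sum>k<n. D $$ (i, k) * R $$ (k, j))"
      using ij D Rc by (simp add: index_mult_mat_sum del: index_mult_mat(1))
    also have "\<dots> = (\<Sum>k<n. if k = i then D $$ (i, i) * R $$ (i, j) else 0)"
      using ij by (intro sum.cong) (auto simp: D_def)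
    also have "\<dots> = D $$ (i, i) * R $$ (i, j)" using ij by simp
    also have "\<dots> = 2 * R $$ (i, j)"
    proof (cases "i = n - 1")
      case True
      then have "R $$ (i, j) = 0" using row ij Rc by (metis carrier_matD index_row(1) index_zero_vec(1))
      then show ?thesis by simp
    qed (use ij in \<open>simp add: D_def\<close>)
    finally show "(D * R) $$ (i, j) = (2 \<cdot>\<^sub>m R) $$ (i, j)" using ij Rc by simp
  qed (use D Rc in auto)
  note assoc = assoc_mult_mat[where n\<^sub>1 = n and n\<^sub>2 = n and n\<^sub>3 = n and n\<^sub>4 = n]
  \<comment> \<open>Conjugating \<open>D\<close> back by \<open>P\<close>, with \<open>Q\<close> as
    its inverse, keeps the determinant and carries the doubling from \<open>R\<close> to
    \<open>A\<close>.\<close>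
  show thesis
  proof (rule that)
    show "Q * D * P \<in> carrier_mat n n" using P Q D by simp
    show "det (Q * D * P) = 1"
      using P Q D detD detPQ by (simp add: det_mult[of _ n] mult.commute)
    have "Q * D * P * A = Q * (D * R)" using P Q D A by (simp add: assoc RP)
    also have "\<dots> = 2 \<cdot>\<^sub>m (Q * R)" unfolding DR using Q Rc by (simp add: mult_smult_distrib)
    also have "Q * R = A" using P Q A QP by (simp add: RP assoc[symmetric])
    finally show "Q * D * P * A = 2 \<cdot>\<^sub>m A" .
  qed
qed

section \<open>Tensor products and permutations of the factors\<close>

lemma length_digits [simp]: "length (digits ds x) = length ds"
  by (induction ds arbitrary: x) auto

lemma digits_less:
  "x < prod_list ds \<Longrightarrow> k < length ds \<Longrightarrow> digits ds x ! k < ds ! k"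
proof (induction ds arbitrary: x k)
  case (Cons d ds)
  have "0 < prod_list ds" using Cons.prems(1) by (cases "prod_list ds") auto
  with Cons show ?case by (cases k) (auto simp: less_mult_imp_div_less)
qed simp

lemma digits_inject:
  "x < prod_list ds \<Longrightarrow> y < prod_list ds \<Longrightarrow> digits ds x = digits ds y \<Longrightarrow> x = y"
proof (induction ds arbitrary: x y)
  case (Cons d ds)
  have "0 < prod_list ds" using Cons.prems(1) by (cases "prod_list ds") auto
  then have "x mod prod_list ds = y mod prod_list ds"
    by (intro Cons.IH) (use Cons.prems in auto)
  moreover have "x div prod_list ds = y div prod_list ds" using Cons.prems by simp
  ultimately show ?case by (metis mod_div_decomp)
qed simp

lemma digits_surj:
  "length xs = length ds \<Longrightarrow> (\<And>k. k < length ds \<Longrightarrow> xs ! k < ds ! k) \<Longrightarrow>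
    \<exists>x<prod_list ds. digits ds x = xs"
proof (induction ds arbitrary: xs)
  case (Cons d ds)
  obtain a as where xs: "xs = a # as" using Cons.prems(1) by (cases xs) auto
  have a: "a < d" using Cons.prems(2)[of 0] xs by simp
  obtain y where y: "y < prod_list ds" "digits ds y = as"
    using Cons.IH[of as] Cons.prems xs by fastforce
  have div_eq_a: "(a * prod_list ds + y) div prod_list ds = a" using y(1) by (intro div_nat_eqI) auto
  have "a * prod_list ds + y < Suc a * prod_list ds" using y by simp
  also have "\<dots> \<le> d * prod_list ds" using a by (intro mult_le_mono1) simp
  finally show ?case using y xs by (intro exI[of _ "a * prod_list ds + y"]) (auto simp: div_eq_a)
qed simp

lemma sum_lessThan_mult:
  fixes f :: "nat \<Rightarrow> nat \<Rightarrow> 'a :: comm_monoid_add"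
  shows "(\<Sum>x<d * D. f (x div D) (x mod D)) = (\<Sum>a<d. \<Sum>b<D. f a b)"
proof -
  have bound: "a * D + b < d * D" if "a < d" "b < D" for a b
  proof -
    have "a * D + b < Suc a * D" using that by simp
    also have "\<dots> \<le> d * D" using that by (intro mult_le_mono1) simp
    finally show ?thesis .
  qed
  have D: "0 < D" if "x < d * D" for x using that by (cases D) auto
  show ?thesis unfolding sum.cartesian_product
    by (rule sum.reindex_bij_witness[where i = "\<lambda>(a, b). a * D + b" and j = "\<lambda>x. (x div D, x mod D)"])
      (auto simp: bound less_mult_imp_div_less D)
qed

text \<open>The distributive law, with the multi-indices encoded as numbers below
  \<open>prod_list ds\<close>. It lets a sum over the basis of the total space split into one sum
  for each party.\<close>

lemma sum_prod_digits:
  fixes f :: "nat \<Rightarrow> nat \<Rightarrow> 'a :: comm_semiring_1"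
  shows "(\<Sum>x<prod_list ds. \<Prod>k<length ds. f k (digits ds x ! k)) = (\<Prod>k<length ds. \<Sum>j<ds ! k. f k j)"
proof (induction ds arbitrary: f)
  case (Cons d ds)
  have "(\<Sum>x<prod_list (d # ds). \<Prod>k<length (d # ds). f k (digits (d # ds) x ! k))
      = (\<Sum>x<d * prod_list ds. f 0 (x div prod_list ds) *
          (\<Prod>k<length ds. f (Suc k) (digits ds (x mod prod_list ds) ! k)))"
    by (simp add: prod.lessThan_Suc_shift del: prod.lessThan_Suc)
  also have "\<dots> = (\<Sum>a<d. \<Sum>b<prod_list ds. f 0 a * (\<Prod>k<length ds. f (Suc k) (digits ds b ! k)))"
    by (rule sum_lessThan_mult)
  also have "\<dots> = (\<Sum>a<d. f 0 a) * (\<Prod>k<length ds. \<Sum>j<ds ! k. f (Suc k) j)"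
    by (simp add: sum_distrib_left[symmetric] sum_distrib_right[symmetric] Cons.IH[of "\<lambda>k. f (Suc k)"])
  finally show ?case by (simp add: prod.lessThan_Suc_shift del: prod.lessThan_Suc)
qed simp

section \<open>Kronecker products of lists of matrices\<close>

lemma dim_tensor [simp]:
  "dim_row (tensor As) = prod_list (map dim_row As)"
  "dim_col (tensor As) = prod_list (map dim_col As)"
  by (simp_all add: tensor_def)

lemma index_tensor:
  assumes "map dim_row As = ms" "map dim_col As = ns" "x < prod_list ms" "y < prod_list ns"
  shows "tensor As $$ (x, y) = (\<Prod>k<length As. (As ! k) $$ (digits ms x ! k, digits ns y ! k))"
  using assms by (simp add: tensor_def)

lemma digits_map_less:
  assumes "x < prod_list (map f As)" "k < length As"
  shows "digits (map f As) x ! k < f (As ! k)"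
  using digits_less[OF assms(1), of k] assms(2) by simp

text \<open>The mixed product rule: the summation over the intermediate basis index factorizes by
  \<open>sum_prod_digits\<close>.\<close>

lemma tensor_mult:
  assumes len: "length As = length Bs" and dims: "\<And>k. k < length As \<Longrightarrow> dim_col (As ! k) = dim_row (Bs ! k)"
  shows "tensor As * tensor Bs = tensor (map2 (*) As Bs)"
proof -
  have mid: "map dim_col As = map dim_row Bs"
    using assms by (intro nth_equalityI) auto
  have l: "map dim_row (map2 (*) As Bs) = map dim_row As"
    and r: "map dim_col (map2 (*) As Bs) = map dim_col Bs"
    using len by (auto intro!: nth_equalityI)
  show ?thesis
  proof (rule eq_matI)
    fix x z assume "x < dim_row (tensor (map2 (*) As Bs))" "z < dim_col (tensor (map2 (*) As Bs))"
    then have x: "x < prod_list (map dim_row As)" and z: "z < prod_list (map dim_col Bs)"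
      unfolding dim_tensor l r .
    have "(tensor As * tensor Bs) $$ (x, z)
      = (\<Sum>y<prod_list (map dim_row Bs). tensor As $$ (x, y) * tensor Bs $$ (y, z))"
      using x z mid by (subst index_mult_mat_sum) auto
    also have "\<dots> = (\<Sum>y<prod_list (map dim_row Bs). \<Prod>k<length (map dim_row Bs).
       (As ! k) $$ (digits (map dim_row As) x ! k, digits (map dim_row Bs) y ! k) *
       (Bs ! k) $$ (digits (map dim_row Bs) y ! k, digits (map dim_col Bs) z ! k))"
      using x z mid len by (intro sum.cong) (simp_all add: index_tensor[OF refl mid] index_tensor[OF refl refl] prod.distrib)
    also have "\<dots> = (\<Prod>k<length Bs. \<Sum>j<dim_row (Bs ! k).
       (As ! k) $$ (digits (map dim_row As) x ! k, j) * (Bs ! k) $$ (j, digits (map dim_col Bs) z ! k))"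
      by (subst sum_prod_digits) simp
    also have "\<dots> = tensor (map2 (*) As Bs) $$ (x, z)"
      using x z len dims digits_map_less[OF x] digits_map_less[OF z]
      unfolding index_tensor[OF l r x z]
      by (auto simp: index_mult_mat_sum simp del: index_mult_mat(1) intro!: prod.cong)
    finally show "(tensor As * tensor Bs) $$ (x, z) = tensor (map2 (*) As Bs) $$ (x, z)" .
  qed (use l r in \<open>simp_all only: dim_tensor index_mult_mat\<close>)
qed

lemma tensor_adjoint: "mat_adjoint (tensor As) = tensor (map mat_adjoint As)"
proof -
  have m: "map dim_row (map mat_adjoint As) = map dim_col As"
      "map dim_col (map mat_adjoint As) = map dim_row As"
    by (auto intro!: nth_equalityI)
  show ?thesis
  proof (rule eq_matI)
    fix x y assume "x < dim_row (tensor (map mat_adjoint As))" "y < dim_col (tensor (map mat_adjoint As))"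
    then have x: "x < prod_list (map dim_col As)" and y: "y < prod_list (map dim_row As)"
      unfolding dim_tensor m .
    show "mat_adjoint (tensor As) $$ (x, y) = tensor (map mat_adjoint As) $$ (x, y)"
      using x y digits_map_less[OF x] digits_map_less[OF y]
      unfolding index_tensor[OF m x y] by (simp add: index_tensor[OF refl refl])
  qed (simp_all only: dim_tensor dim_mat_adjoint m)
qed

text \<open>Scalars may differ from factor to factor, so taking \<open>c k = 1\<close> at all
  positions but one also covers the scaling of a single factor by \<open>2\<close> or
  \<open>0\<close>.\<close>

lemma tensor_smult:
  assumes "length Bs = length As" "\<And>k. k < length As \<Longrightarrow> Bs ! k = c k \<cdot>\<^sub>m As ! k"
  shows "tensor Bs = (\<Prod>k<length As. c k) \<cdot>\<^sub>m tensor As"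
proof -
  have m: "map dim_row Bs = map dim_row As" "map dim_col Bs = map dim_col As"
    using assms by (auto intro!: nth_equalityI)
  show ?thesis
  proof (rule eq_matI)
    fix x y assume "x < dim_row ((\<Prod>k<length As. c k) \<cdot>\<^sub>m tensor As)" "y < dim_col ((\<Prod>k<length As. c k) \<cdot>\<^sub>m tensor As)"
    then have x: "x < prod_list (map dim_row As)" and y: "y < prod_list (map dim_col As)"
      by simp_all
    have "tensor Bs $$ (x, y) = (\<Prod>k<length As. c k * (As ! k) $$
        (digits (map dim_row As) x ! k, digits (map dim_col As) y ! k))"
      using x y assms digits_map_less[OF x] digits_map_less[OF y]
      unfolding index_tensor[OF m x y] by (auto intro!: prod.cong)
    then show "tensor Bs $$ (x, y) = ((\<Prod>k<length As. c k) \<cdot>\<^sub>m tensor As) $$ (x, y)"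
      using x y by (simp add: index_tensor[OF refl refl] prod.distrib)
  qed (simp_all only: dim_tensor index_smult_mat m)
qed

lemma tensor_one: "tensor (map 1\<^sub>m ds) = 1\<^sub>m (prod_list ds)"
proof -
  have m: "map dim_row (map 1\<^sub>m ds :: complex mat list) = ds" "map dim_col (map 1\<^sub>m ds :: complex mat list) = ds"
    by (auto intro!: nth_equalityI)
  show ?thesis
  proof (rule eq_matI)
    fix x y assume "x < dim_row (1\<^sub>m (prod_list ds) :: complex mat)" "y < dim_col (1\<^sub>m (prod_list ds) :: complex mat)"
    then have x: "x < prod_list ds" and y: "y < prod_list ds" by auto
    have "tensor (map 1\<^sub>m ds) $$ (x, y)
        = (\<Prod>k<length ds. if digits ds x ! k = digits ds y ! k then 1 else 0)"
      using x y digits_less[OF x] digits_less[OF y]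
      unfolding index_tensor[OF m x y] by (auto intro!: prod.cong)
    also have "\<dots> = (if x = y then 1 else 0)"
    proof (cases "x = y")
      case False
      then obtain k where "k < length ds" "digits ds x ! k \<noteq> digits ds y ! k"
        using digits_inject[OF x y] nth_equalityI[of "digits ds x" "digits ds y"] by auto
      then show ?thesis using False by auto
    qed simp
    finally show "tensor (map 1\<^sub>m ds) $$ (x, y) = 1\<^sub>m (prod_list ds) $$ (x, y)" using x y by simp
  qed (simp_all only: dim_tensor m index_one_mat)
qed

lemma map_dim_eq:
  assumes "length As = length ds" "\<And>i. i < length ds \<Longrightarrow> As ! i \<in> carrier_mat (ds ! i) (ds ! i)"
  shows "map dim_row As = ds" "map dim_col As = ds"
  using assms(1) carrier_matD[OF assms(2)] by (auto intro!: nth_equalityI)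

lemma tensor_carrier:
  assumes "length As = length ds" "\<And>i. i < length ds \<Longrightarrow> As ! i \<in> carrier_mat (ds ! i) (ds ! i)"
  shows "tensor As \<in> carrier_mat (prod_list ds) (prod_list ds)"
  using map_dim_eq[OF assms] by (intro carrier_matI) simp_all

lemma tensor_isometry:
  assumes "length Us = length ds" "\<And>i. i < length ds \<Longrightarrow> unitary_mat (ds ! i) (Us ! i)"
  shows "mat_adjoint (tensor Us) * tensor Us = 1\<^sub>m (prod_list ds)"
proof -
  have "map2 (*) (map mat_adjoint Us) Us = map 1\<^sub>m ds"
    using assms by (auto intro!: nth_equalityI simp: unitary_mat_def)
  then show ?thesis
    unfolding tensor_adjoint by (subst tensor_mult) (auto simp: tensor_one)
qed

section \<open>The permutation operator\<close>

lemma perm_op_carrier: "perm_op ds P \<in> carrier_mat (prod_list ds) (prod_list ds)"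
  by (simp add: perm_op_def)

text \<open>Column \<open>y\<close> has exactly one nonzero entry, in the row \<open>x\<close> whose
  digits are those of \<open>y\<close> rearranged, and \<open>x\<close> determines \<open>y\<close>
  in turn. Hence the columns are distinct standard basis vectors.\<close>

lemma perm_op_isometry:
  assumes P: "P permutes {..<length ds}" and dsP: "\<forall>i<length ds. ds ! P i = ds ! i"
  shows "mat_adjoint (perm_op ds P) * perm_op ds P = 1\<^sub>m (prod_list ds)"
proof (rule eq_matI)
  let ?n = "length ds" and ?D = "prod_list ds"
  fix y z assume "y < dim_row (1\<^sub>m ?D :: complex mat)" "z < dim_col (1\<^sub>m ?D :: complex mat)"
  then have y: "y < ?D" and z: "z < ?D" by auto
  define R where "R x y \<longleftrightarrow> (\<forall>k<?n. digits ds x ! P k = digits ds y ! k)" for x y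
  have inv_less: "inv_into UNIV P k < ?n" if "k < ?n" for k
    using permutes_in_image[OF permutes_inv[OF P], of k] that by simp
  \<comment> \<open>The rearranged digits form an admissible index because \<open>P\<close> only
    exchanges parties of equal dimension.\<close>
  have "\<exists>x<?D. digits ds x = map (\<lambda>k. digits ds y ! inv_into UNIV P k) [0..<?n]"
  proof (rule digits_surj)
    fix k assume k: "k < ?n"
    have "digits ds y ! inv_into UNIV P k < ds ! inv_into UNIV P k" by (rule digits_less[OF y inv_less[OF k]])
    also have "\<dots> = ds ! k" using dsP inv_less[OF k] permutes_inverses(1)[OF P, of k] by force
    finally show "map (\<lambda>k. digits ds y ! inv_into UNIV P k) [0..<?n] ! k < ds ! k" using k by simp
  qed simp
  then obtain x where x: "x < ?D" "digits ds x = map (\<lambda>k. digits ds y ! inv_into UNIV P k) [0..<?n]" by blast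
  have P_less: "P k < ?n" if "k < ?n" for k using permutes_in_image[OF P, of k] that by simp
  have Rx: "R x y" unfolding R_def x(2) using P_less permutes_inverses(2)[OF P] by simp
  have uniq: "x' = x" if "R x' y" "x' < ?D" for x'
  proof -
    have "digits ds x' ! k = digits ds x ! k" if k: "k < ?n" for k
      using \<open>R x' y\<close> Rx inv_less[OF k] permutes_inverses(1)[OF P, of k] unfolding R_def by metis
    then have "digits ds x' = digits ds x" by (intro nth_equalityI) auto
    then show ?thesis by (rule digits_inject[OF that(2) x(1)])
  qed
  have yz: "y = z" if "R x z"
    using that Rx unfolding R_def by (intro digits_inject[OF y z] nth_equalityI) auto
  have "(mat_adjoint (perm_op ds P) * perm_op ds P) $$ (y, z)
      = (\<Sum>x'<?D. (if R x' y then 1 else 0) * (if R x' z then 1 else 0))"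
    using y z by (subst index_mult_mat_sum) (auto simp: perm_op_def R_def intro!: sum.cong)
  also have "\<dots> = (\<Sum>x'<?D. if x' = x then (if y = z then 1 else 0) else 0)"
  proof (rule sum.cong)
    fix x' assume "x' \<in> {..<?D}"
    then have "R x' y \<longleftrightarrow> x' = x" using Rx uniq by blast
    moreover have "R x z \<longleftrightarrow> y = z" using Rx yz by blast
    ultimately show "(if R x' y then 1 else 0) * (if R x' z then 1 else 0)
        = (if x' = x then if y = z then 1 else 0 else (0 :: complex))" by simp
  qed simp
  also have "\<dots> = 1\<^sub>m ?D $$ (y, z)" using x y z by simp
  finally show "(mat_adjoint (perm_op ds P) * perm_op ds P) $$ (y, z) = 1\<^sub>m ?D $$ (y, z)" .
qed (simp_all add: perm_op_def)

section \<open>The trace identity for LOCC protocols\<close>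

text \<open>Input dimensions \<open>ds\<close>, output dimensions \<open>es\<close>. The factors may
  be rectangular, since the remainder of a protocol can start from local dimensions changed by an
  earlier round.\<close>

definition kraus_list :: "nat list \<Rightarrow> nat list \<Rightarrow> complex mat list \<Rightarrow> bool" where
  "kraus_list es ds K \<longleftrightarrow>
     length ds = length es \<and> length K = length es \<and>
     (\<forall>i<length es. K ! i \<in> carrier_mat (es ! i) (ds ! i))"

text \<open>The operator \<open>B\<close> is applied before the remaining protocol \<open>L\<close>,
  hence it multiplies from the right and the input dimension of \<open>L\<close> at \<open>i\<close>
  is \<open>dim_row B\<close>.\<close>

lemma kraus_list_step:
  assumes K: "kraus_list es (ds[i := dim_row B]) L" and i: "i < length ds" and B: "dim_col B = ds ! i"
  shows "kraus_list es ds (L[i := L ! i * B])"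
proof -
  have "L[i := L ! i * B] ! k \<in> carrier_mat (es ! k) (ds ! k)" if k: "k < length es" for k
  proof -
    have L: "L ! k \<in> carrier_mat (es ! k) (ds[i := dim_row B] ! k)"
      using K k by (simp add: kraus_list_def)
    show ?thesis
    proof (cases "k = i")
      case True
      then have "L ! k \<in> carrier_mat (es ! k) (dim_row B)" using L i by simp
      then have "L ! k * B \<in> carrier_mat (es ! k) (ds ! k)"
        using B True by (auto intro!: carrier_matI)
      then show ?thesis using True K k by (simp add: kraus_list_def)
    qed (use L in simp)
  qed
  then show ?thesis using K by (simp add: kraus_list_def)
qed

lemma sum_list_concat_nth:
  fixes f :: "'a \<Rightarrow> 'b :: comm_monoid_add"
  shows "(\<Sum>x\<leftarrow>concat xss. f x) = (\<Sum>j<length xss. \<Sum>x\<leftarrow>xss ! j. f x)"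
  by (induction xss) (simp_all add: sum.lessThan_Suc_shift del: sum.lessThan_Suc)

lemma locc_kraus_list: "locc es ds Ks \<Longrightarrow> \<forall>K\<in>set Ks. kraus_list es ds K"
proof (induction rule: locc.induct)
  case locc_stop
  then show ?case by (simp add: kraus_list_def)
next
  case (locc_step i ds Bs Kss)
  show ?case
  proof
    fix K assume "K \<in> set (concat (map2 (\<lambda>B Ks. map (\<lambda>K. K[i := K ! i * B]) Ks) Bs Kss))"
    then obtain j L where j: "j < length Bs" and L: "L \<in> set (Kss ! j)"
      and K: "K = L[i := L ! i * Bs ! j]" by (auto simp: set_zip)
    show "kraus_list es ds K" unfolding K
      using locc_step.hyps(1,2) locc_step.IH j L by (intro kraus_list_step) auto
  qed
qed

lemma sandwich_mult:
  fixes A B X :: "complex mat"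
  assumes A: "A \<in> carrier_mat l m" and B: "B \<in> carrier_mat m n" and X: "X \<in> carrier_mat n n"
  shows "A * B * X * mat_adjoint (A * B) = A * (B * X * mat_adjoint B) * mat_adjoint A"
proof -
  have "A * B * X * mat_adjoint (A * B) = A * B * X * (mat_adjoint B * mat_adjoint A)"
    using A B by (simp add: mat_adjoint_mult)
  also have "\<dots> = A * B * X * mat_adjoint B * mat_adjoint A"
    by (rule assoc_mult_mat[symmetric, where n\<^sub>1 = l and n\<^sub>2 = n and n\<^sub>3 = m and n\<^sub>4 = l]) (use A B X in auto)
  also have "\<dots> = A * (B * X) * mat_adjoint B * mat_adjoint A"
    unfolding assoc_mult_mat[OF A B X] ..
  also have "\<dots> = A * (B * X * mat_adjoint B) * mat_adjoint A"
    by (intro arg_cong[of _ _ "\<lambda>Y. Y * mat_adjoint A"] assoc_mult_mat[where n\<^sub>1 = l and n\<^sub>2 = m and n\<^sub>3 = n and n\<^sub>4 = m]) (use A B X in auto)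
  finally show ?thesis .
qed

text \<open>Quantifying over the product operator \<open>Xs\<close> lets the induction absorb a local Kraus operator
  \<open>B\<close> into it, replacing \<open>Xs ! i\<close> by \<open>B * Xs ! i * mat_adjoint B\<close>.\<close>

lemma locc_trace:
  assumes "locc es ds Ks" "length Xs = length ds"
    "\<forall>i<length ds. Xs ! i \<in> carrier_mat (ds ! i) (ds ! i)"
  shows "(\<Sum>K\<leftarrow>Ks. \<Prod>i<length ds. trace (K ! i * Xs ! i * mat_adjoint (K ! i)))
    = (\<Prod>i<length ds. trace (Xs ! i))"
  using assms
proof (induction arbitrary: Xs rule: locc.induct)
  case locc_stop
  have "1\<^sub>m (es ! i) * Xs ! i * 1\<^sub>m (es ! i) = Xs ! i" if "i < length es" for i
    using locc_stop that by (metis left_mult_one_mat right_mult_one_mat)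
  then show ?case by simp
next
  case (locc_step i ds Bs Kss)
  let ?n = "length ds"
  let ?X = "Xs ! i"
  note i = \<open>i < ?n\<close>
  have X: "?X \<in> carrier_mat (ds ! i) (ds ! i)" using locc_step.prems i by blast
  have "(\<Sum>K\<leftarrow>concat (map2 (\<lambda>B Ks. map (\<lambda>K. K[i := K ! i * B]) Ks) Bs Kss).
      \<Prod>k<?n. trace (K ! k * Xs ! k * mat_adjoint (K ! k)))
    = (\<Sum>j<length Bs. \<Sum>L\<leftarrow>Kss ! j. \<Prod>k<?n.
        trace (L[i := L ! i * Bs ! j] ! k * Xs ! k * mat_adjoint (L[i := L ! i * Bs ! j] ! k)))"
    unfolding sum_list_concat_nth using locc_step.hyps(4) by (simp add: o_def)
  also have "\<dots> = (\<Sum>j<length Bs. trace (Bs ! j * ?X * mat_adjoint (Bs ! j)) *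
      (\<Prod>k\<in>{..<?n} - {i}. trace (Xs ! k)))"
  proof (rule sum.cong)
    fix j assume "j \<in> {..<length Bs}"
    then have j: "j < length Bs" by simp
    let ?B = "Bs ! j"
    let ?es = "ds[i := dim_row ?B]"
    let ?Y = "?B * ?X * mat_adjoint ?B"
    let ?Ys = "Xs[i := ?Y]"
    have B: "?B \<in> carrier_mat (dim_row ?B) (ds ! i)" using locc_step.hyps(2) j by (intro carrier_matI) auto
    have IH: "locc es ?es (Kss ! j)"
      "\<And>Xs. length Xs = length ?es \<Longrightarrow> \<forall>k<length ?es. Xs ! k \<in> carrier_mat (?es ! k) (?es ! k) \<Longrightarrow>
        (\<Sum>K\<leftarrow>Kss ! j. \<Prod>k<length ?es. trace (K ! k * Xs ! k * mat_adjoint (K ! k)))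
        = (\<Prod>k<length ?es. trace (Xs ! k))"
      using locc_step.IH j by blast+
    have Yk: "?Ys ! k = (if k = i then ?Y else Xs ! k)" if "k < ?n" for k
      using locc_step.prems i that by auto
    have Yc: "?Ys ! k \<in> carrier_mat (?es ! k) (?es ! k)" if "k < ?n" for k
      unfolding Yk[OF that] using locc_step.prems i that by auto
    \<comment> \<open>For the acting party, \<open>?B\<close> moves from the Kraus factor into the
      operator it acts on; all other parties are untouched. The induction hypothesis then applies to
      \<open>?Ys\<close>, whose dimensions match those after outcome \<open>j\<close>.\<close>
    have step: "trace (L[i := L ! i * ?B] ! k * Xs ! k * mat_adjoint (L[i := L ! i * ?B] ! k))
        = trace (L ! k * ?Ys ! k * mat_adjoint (L ! k))"
      if "L \<in> set (Kss ! j)" "k < ?n" for L k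
    proof (cases "k = i")
      case True
      have kl: "kraus_list es ?es L" using locc_kraus_list[OF IH(1)] that by blast
      then have len: "length L = ?n" by (simp add: kraus_list_def)
      have Li: "L ! i \<in> carrier_mat (es ! i) (dim_row ?B)" 
      proof -
        have "i < length es" using kl i by (simp add: kraus_list_def)
        then have "L ! i \<in> carrier_mat (es ! i) (?es ! i)" using kl unfolding kraus_list_def by blast
        then show ?thesis using i by simp
      qed
      have Lk: "L[i := L ! i * ?B] ! i = L ! i * ?B" using i len by simp
      have Ys: "?Ys ! i = ?Y" using i locc_step.prems(1) by simp
      show ?thesis unfolding True Lk Ys sandwich_mult[OF Li B X] ..
    qed simp
    have "(\<Sum>L\<leftarrow>Kss ! j. \<Prod>k<?n.
        trace (L[i := L ! i * ?B] ! k * Xs ! k * mat_adjoint (L[i := L ! i * ?B] ! k)))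
      = (\<Sum>L\<leftarrow>Kss ! j. \<Prod>k<?n. trace (L ! k * ?Ys ! k * mat_adjoint (L ! k)))"
      by (intro arg_cong[of _ _ sum_list] map_cong prod.cong refl step) auto
    also have "\<dots> = (\<Prod>k<?n. trace (?Ys ! k))"
      using IH(2)[of ?Ys] Yc locc_step.prems by simp
    also have "\<dots> = trace (?Ys ! i) * (\<Prod>k\<in>{..<?n} - {i}. trace (?Ys ! k))"
      using i by (intro prod.remove) auto
    also have "\<dots> = trace ?Y * (\<Prod>k\<in>{..<?n} - {i}. trace (Xs ! k))"
      using Yk i by simp
    finally show "(\<Sum>L\<leftarrow>Kss ! j. \<Prod>k<?n.
        trace (L[i := L ! i * ?B] ! k * Xs ! k * mat_adjoint (L[i := L ! i * ?B] ! k)))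
      = trace ?Y * (\<Prod>k\<in>{..<?n} - {i}. trace (Xs ! k))" .
  qed simp
  also have "\<dots> = (\<Sum>j<length Bs. trace (Bs ! j * ?X * mat_adjoint (Bs ! j))) *
      (\<Prod>k\<in>{..<?n} - {i}. trace (Xs ! k))"
    by (simp add: sum_distrib_right)
  also have "(\<Sum>j<length Bs. trace (Bs ! j * ?X * mat_adjoint (Bs ! j))) = trace ?X"
  proof -
    \<comment> \<open>Cyclicity of the trace collects the products \<open>mat_adjoint B * B\<close>,
      to which the completeness relation of the round applies.\<close>
    have cyc: "trace (B * ?X * mat_adjoint B) = trace (?X * (mat_adjoint B * B))" if "B \<in> set Bs" for B
    proof -
      have "dim_col B = ds ! i" using locc_step.hyps(2) that by blast
      then obtain m where B: "B \<in> carrier_mat m (ds ! i)" using carrier_matI[OF refl] by blast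
      have "trace (B * ?X * mat_adjoint B) = trace (B * (?X * mat_adjoint B))"
        using B X by (intro arg_cong[of _ _ trace] assoc_mult_mat) auto
      also have "\<dots> = trace (?X * mat_adjoint B * B)"
        by (rule trace_mult_commute[where m = m and n = "ds ! i"]) (use B X in auto)
      also have "\<dots> = trace (?X * (mat_adjoint B * B))"
        using B X by (intro arg_cong[of _ _ trace] assoc_mult_mat) auto
      finally show ?thesis .
    qed
    have "(\<Sum>j<length Bs. trace (Bs ! j * ?X * mat_adjoint (Bs ! j)))
        = (\<Sum>B\<leftarrow>Bs. trace (B * ?X * mat_adjoint B))"
      by (simp add: sum_list_sum_nth atLeast0LessThan)
    also have "\<dots> = (\<Sum>B\<leftarrow>Bs. trace (?X * (mat_adjoint B * B)))"
      by (intro arg_cong[of _ _ sum_list] map_cong refl cyc)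
    also have "\<dots> = trace (?X * msum (ds ! i) (ds ! i) (map (\<lambda>B. mat_adjoint B * B) Bs))"
    proof (subst trace_mult_msum[where m = "ds ! i" and n = "ds ! i"])
      show "\<forall>A\<in>set (map (\<lambda>B. mat_adjoint B * B) Bs). A \<in> carrier_mat (ds ! i) (ds ! i)"
        using locc_step.hyps(2) by (auto intro!: carrier_matI)
    qed (use X in \<open>simp_all add: o_def\<close>)
    also have "\<dots> = trace ?X" unfolding locc_step.hyps(3) using X by simp
    finally show ?thesis .
  qed
  also have "trace ?X * (\<Prod>k\<in>{..<?n} - {i}. trace (Xs ! k)) = (\<Prod>k<?n. trace (Xs ! k))"
    using i by (intro prod.remove[symmetric]) auto
  finally show ?case .
qed

text \<open>\<open>locc_trace\<close> at identity matrices. Divided by the product of the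
  dimensions, it says that the arithmetic-mean bounds of all Kraus operators add up to
  \<open>1\<close>.\<close>

lemma locc_sum_frob:
  assumes "locc ds ds Ks"
  shows "(\<Sum>K\<leftarrow>Ks. \<Prod>i<length ds. frob (K ! i)) = (\<Prod>i<length ds. real (ds ! i))"
proof -
  have one: "K ! i * 1\<^sub>m (ds ! i) = K ! i" if "K \<in> set Ks" "i < length ds" for K i
    using locc_kraus_list[OF assms] that
    unfolding kraus_list_def by (metis right_mult_one_mat)
  have "complex_of_real (\<Sum>K\<leftarrow>Ks. \<Prod>i<length ds. frob (K ! i))
      = (\<Sum>K\<leftarrow>Ks. \<Prod>i<length ds. of_real (frob (K ! i)))"
    by (induction Ks) simp_all
  also have "\<dots> = (\<Sum>K\<leftarrow>Ks. \<Prod>i<length ds.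
      trace (K ! i * map 1\<^sub>m ds ! i * mat_adjoint (K ! i)))"
    by (intro arg_cong[of _ _ sum_list] map_cong prod.cong refl)
      (simp add: one trace_mult_adjoint)
  also have "\<dots> = (\<Prod>i<length ds. trace (map 1\<^sub>m ds ! i))"
    by (rule locc_trace[OF assms]) auto
  also have "\<dots> = of_real (\<Prod>i<length ds. real (ds ! i))" by simp
  finally show ?thesis by (simp only: of_real_eq_iff)
qed

section \<open>Isometries and strict convexity\<close>

lemma smult_sandwich:
  fixes T X :: "complex mat"
  assumes T: "T \<in> carrier_mat m n" and X: "X \<in> carrier_mat n n"
  shows "(c \<cdot>\<^sub>m T) * X * mat_adjoint (c \<cdot>\<^sub>m T)
    = complex_of_real ((cmod c)\<^sup>2) \<cdot>\<^sub>m (T * X * mat_adjoint T)"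
proof -
  have "(c \<cdot>\<^sub>m T) * X * mat_adjoint (c \<cdot>\<^sub>m T) = (c \<cdot>\<^sub>m (T * X)) * (cnj c \<cdot>\<^sub>m mat_adjoint T)"
    using T X by (simp add: mult_smult_assoc_mat)
  also have "\<dots> = cnj c \<cdot>\<^sub>m ((c \<cdot>\<^sub>m (T * X)) * mat_adjoint T)"
    by (rule mult_smult_distrib[where nr = m and n = n and nc = m]) (use T X in auto)
  also have "\<dots> = cnj c \<cdot>\<^sub>m (c \<cdot>\<^sub>m (T * X * mat_adjoint T))"
    by (intro arg_cong[of _ _ "\<lambda>Y. cnj c \<cdot>\<^sub>m Y"] mult_smult_assoc_mat[where nr = m and n = n and nc = m]) (use T X in auto)
  also have "\<dots> = complex_of_real ((cmod c)\<^sup>2) \<cdot>\<^sub>m (T * X * mat_adjoint T)"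
    by (rule eq_matI) (simp_all add: complex_norm_square mult_ac del: index_mult_mat(1) of_real_power)
  finally show ?thesis .
qed

lemma inner_prod_adjoint:
  fixes A :: "complex mat"
  assumes "A \<in> carrier_mat m n" "x \<in> carrier_vec n" "y \<in> carrier_vec m"
  shows "(A *\<^sub>v x) \<bullet>c y = x \<bullet>c (mat_adjoint A *\<^sub>v y)"
proof -
  have "(A *\<^sub>v x) \<bullet>c y = (\<Sum>i<m. (\<Sum>j<n. A $$ (i, j) * x $ j) * cnj (y $ i))"
    using assms by (simp add: scalar_prod_def atLeast0LessThan)
  also have "\<dots> = (\<Sum>j<n. x $ j * cnj (\<Sum>i<m. cnj (A $$ (i, j)) * y $ i))"
    unfolding sum_distrib_left sum_distrib_right cnj_sum
    by (subst sum.swap) (simp add: mult_ac)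
  also have "\<dots> = x \<bullet>c (mat_adjoint A *\<^sub>v y)"
    using assms by (simp add: scalar_prod_def atLeast0LessThan)
  finally show ?thesis .
qed

section \<open>Rank-one operators and conjugation by isometries\<close>

lemma ket_bra_carrier [simp]: "\<psi> \<in> carrier_vec n \<Longrightarrow> ket_bra \<psi> \<in> carrier_mat n n"
  by (auto simp: ket_bra_def)

lemma ket_bra_smult: "ket_bra (c \<cdot>\<^sub>v \<psi>) = complex_of_real ((cmod c)\<^sup>2) \<cdot>\<^sub>m ket_bra \<psi>"
  unfolding complex_norm_square by (rule eq_matI) (auto simp: ket_bra_def)

lemma ket_bra_mult_mat_vec:
  assumes "T \<in> carrier_mat m n" "\<psi> \<in> carrier_vec n"
  shows "ket_bra (T *\<^sub>v \<psi>) = T * ket_bra \<psi> * mat_adjoint T"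
proof (rule eq_matI)
  fix a b assume "a < dim_row (T * ket_bra \<psi> * mat_adjoint T)" "b < dim_col (T * ket_bra \<psi> * mat_adjoint T)"
  then have a: "a < m" and b: "b < m" using assms by auto
  have "(T * ket_bra \<psi> * mat_adjoint T) $$ (a, b)
      = (\<Sum>k<n. (\<Sum>l<n. T $$ (a, l) * (\<psi> $ l * cnj (\<psi> $ k))) * cnj (T $$ (b, k)))"
    using assms a b by (simp add: index_mult_mat_sum ket_bra_def del: index_mult_mat(1))
  also have "\<dots> = (\<Sum>l<n. T $$ (a, l) * \<psi> $ l) * cnj (\<Sum>k<n. T $$ (b, k) * \<psi> $ k)"
    unfolding sum_distrib_left sum_distrib_right cnj_sum by (simp add: mult_ac)
  also have "\<dots> = ket_bra (T *\<^sub>v \<psi>) $$ (a, b)"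
    using assms a b by (simp add: ket_bra_def scalar_prod_def atLeast0LessThan)
  finally show "ket_bra (T *\<^sub>v \<psi>) $$ (a, b) = (T * ket_bra \<psi> * mat_adjoint T) $$ (a, b)" ..
qed (use assms in \<open>auto simp: ket_bra_def\<close>)

text \<open>The convex roof property speaks of density matrices only, so the permuted state has to
  be recognized as one before its value can be bounded by a decomposition.\<close>

lemma density_mat_isometry:
  assumes \<rho>: "density_mat D \<rho>" and V: "V \<in> carrier_mat D D" and iso: "mat_adjoint V * V = 1\<^sub>m D"
  shows "density_mat D (V * \<rho> * mat_adjoint V)"
proof -
  have R: "\<rho> \<in> carrier_mat D D" and adj: "mat_adjoint \<rho> = \<rho>"
    and pos: "\<And>v. v \<in> carrier_vec D \<Longrightarrow> 0 \<le> (\<rho> *\<^sub>v v) \<bullet>c v" and tr: "trace \<rho> = 1"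
    using \<rho> unfolding density_mat_def trace_def by auto
  note assoc = assoc_mult_mat[where n\<^sub>1 = D and n\<^sub>2 = D and n\<^sub>3 = D and n\<^sub>4 = D]
  have "mat_adjoint (V * \<rho> * mat_adjoint V) = V * \<rho> * mat_adjoint V"
    using V R by (simp add: mat_adjoint_mult adj assoc)
  moreover have "0 \<le> (V * \<rho> * mat_adjoint V *\<^sub>v v) \<bullet>c v" if v: "v \<in> carrier_vec D" for v
  proof -
    define w where "w = mat_adjoint V *\<^sub>v v"
    have w: "w \<in> carrier_vec D" unfolding w_def
      by (rule mult_mat_vec_carrier[OF mat_adjoint_carrier[OF V] v])
    have "V * \<rho> * mat_adjoint V *\<^sub>v v = V *\<^sub>v (\<rho> *\<^sub>v w)"
      unfolding assoc_mult_mat_vec[OF mult_carrier_mat[OF V R] mat_adjoint_carrier[OF V] v]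
        w_def[symmetric] by (rule assoc_mult_mat_vec[OF V R w])
    moreover have "(V *\<^sub>v (\<rho> *\<^sub>v w)) \<bullet>c v = (\<rho> *\<^sub>v w) \<bullet>c w"
      unfolding w_def[symmetric] using inner_prod_adjoint[OF V _ v, of "\<rho> *\<^sub>v w"] R w
      by (simp add: w_def)
    ultimately show ?thesis using pos[OF w] by simp
  qed
  moreover have "trace (V * \<rho> * mat_adjoint V) = 1"
  proof -
    have "trace (V * \<rho> * mat_adjoint V) = trace (mat_adjoint V * (V * \<rho>))"
      by (rule trace_mult_commute[where m = D and n = D]) (use V R in auto)
    also have "\<dots> = trace (mat_adjoint V * V * \<rho>)"
      using V R by (intro arg_cong[of _ _ trace] assoc[symmetric]) auto
    also have "\<dots> = 1" unfolding iso using R tr by simp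
    finally show ?thesis .
  qed
  moreover have "V * \<rho> * mat_adjoint V \<in> carrier_mat D D" using V R by auto
  ultimately show ?thesis unfolding density_mat_def trace_def by auto
qed

lemma frob_adjoint: "frob (mat_adjoint A) = frob A"
proof -
  have "complex_of_real (frob (mat_adjoint A)) = of_real (frob A)"
    using trace_mult_adjoint[of A] trace_adjoint_mult[of "mat_adjoint A"] by simp
  then show ?thesis by (simp only: of_real_eq_iff)
qed

lemma frob_isometry_mult:
  assumes "V \<in> carrier_mat n n" "A \<in> carrier_mat n m" "mat_adjoint V * V = 1\<^sub>m n"
  shows "frob (V * A) = frob A"
proof -
  have "mat_adjoint (V * A) * (V * A) = mat_adjoint A * mat_adjoint V * (V * A)"
    using assms by (simp add: mat_adjoint_mult)
  also have "\<dots> = mat_adjoint A * (mat_adjoint V * (V * A))"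
    by (rule assoc_mult_mat[where n\<^sub>1 = m and n\<^sub>2 = n and n\<^sub>3 = n and n\<^sub>4 = m]) (use assms in auto)
  also have "\<dots> = mat_adjoint A * (mat_adjoint V * V * A)"
    using assms by (intro arg_cong[of _ _ "(*) (mat_adjoint A)"]
      assoc_mult_mat[symmetric, where n\<^sub>1 = n and n\<^sub>2 = n and n\<^sub>3 = n and n\<^sub>4 = m]) auto
  also have "\<dots> = mat_adjoint A * A" unfolding assms(3) using assms(2) by simp
  finally have "complex_of_real (frob (V * A)) = of_real (frob A)"
    unfolding trace_adjoint_mult[symmetric] by simp
  then show ?thesis by (simp only: of_real_eq_iff)
qed

text \<open>Left multiplication by an isometry preserves \<open>frob\<close>. The right factor is
  brought to the left by taking adjoints, which preserve \<open>frob\<close> as well.\<close>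

lemma frob_isometry_sandwich:
  assumes V: "V \<in> carrier_mat n n" and A: "A \<in> carrier_mat n n" and iso: "mat_adjoint V * V = 1\<^sub>m n"
  shows "frob (V * A * mat_adjoint V) = frob A"
proof -
  have "frob (V * A * mat_adjoint V) = frob (V * mat_adjoint (V * A))"
    using V A frob_adjoint[of "V * A * mat_adjoint V"] by (simp add: mat_adjoint_mult)
  also have "\<dots> = frob (mat_adjoint (V * A))"
    by (rule frob_isometry_mult[OF V _ iso, where m = n]) (use V A in auto)
  also have "\<dots> = frob A" unfolding frob_adjoint by (rule frob_isometry_mult[OF V A iso])
  finally show ?thesis .
qed

lemma frob_minus:
  assumes "X \<in> carrier_mat m n" "Y \<in> carrier_mat m n"
  shows "frob (X - Y) = frob X - 2 * Re (trace (mat_adjoint X * Y)) + frob Y"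
proof -
  have "trace (mat_adjoint X * Y) = trace (Y * mat_adjoint X)"
    by (rule trace_mult_commute[where m = n and n = m]) (use assms in auto)
  also have "\<dots> = (\<Sum>i<m. \<Sum>k<n. Y $$ (i, k) * mat_adjoint X $$ (k, i))"
    by (rule trace_mult_eq_sum) (use assms in auto)
  also have "\<dots> = (\<Sum>i<m. \<Sum>k<n. Y $$ (i, k) * cnj (X $$ (i, k)))"
    using assms by simp
  finally have tr: "trace (mat_adjoint X * Y) = (\<Sum>i<m. \<Sum>k<n. Y $$ (i, k) * cnj (X $$ (i, k)))" .
  have "(cmod (x - y))\<^sup>2 = (cmod x)\<^sup>2 - 2 * Re (y * cnj x) + (cmod y)\<^sup>2" for x y :: complex
    unfolding cmod_power2 by (simp add: power2_eq_square algebra_simps)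
  then show ?thesis unfolding tr frob_def using assms
    by (simp add: sum.distrib sum_subtractf sum_distrib_left)
qed

text \<open>Strict convexity of the Hilbert--Schmidt norm, in the form
  \<open>\<Sum>K. q K * frob (\<sigma> - S K) = 0\<close>.\<close>

lemma convex_combination_equal_frob:
  assumes S: "\<And>K. K \<in> set Ks \<Longrightarrow> S K \<in> carrier_mat m n \<and> frob (S K) = frob \<sigma>"
    and q: "\<And>K. K \<in> set Ks \<Longrightarrow> 0 \<le> q K" "(\<Sum>K\<leftarrow>Ks. q K) = 1"
    and \<sigma>: "\<sigma> = msum m n (map (\<lambda>K. complex_of_real (q K) \<cdot>\<^sub>m S K) Ks)"
  shows "\<exists>K\<in>set Ks. S K = \<sigma>"
proof -
  have C: "\<sigma> \<in> carrier_mat m n" unfolding \<sigma> using S by (intro msum_carrier) auto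
  have smult: "trace (mat_adjoint \<sigma> * (complex_of_real (q K) \<cdot>\<^sub>m S K))
      = of_real (q K) * trace (mat_adjoint \<sigma> * S K)" if "K \<in> set Ks" for K
  proof -
    have "mat_adjoint \<sigma> * (complex_of_real (q K) \<cdot>\<^sub>m S K) = complex_of_real (q K) \<cdot>\<^sub>m (mat_adjoint \<sigma> * S K)"
      using C S[OF that] by (intro mult_smult_distrib) auto
    moreover have "mat_adjoint \<sigma> * S K \<in> carrier_mat n n"
      using S[OF that] by (intro mult_carrier_mat[OF mat_adjoint_carrier[OF C]]) simp
    ultimately show ?thesis by (simp add: trace_smult)
  qed
  \<comment> \<open>Pairing \<open>\<sigma>\<close> with its own decomposition shows that the
    weighted mean of its inner products with the \<open>S K\<close> is
    \<open>frob \<sigma>\<close>.\<close>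
  have "complex_of_real (frob \<sigma>) = trace (mat_adjoint \<sigma> * \<sigma>)" by (simp add: trace_adjoint_mult)
  also have "\<dots> = trace (mat_adjoint \<sigma> * msum m n (map (\<lambda>K. complex_of_real (q K) \<cdot>\<^sub>m S K) Ks))"
    unfolding \<sigma>[symmetric] ..
  also have "\<dots> = (\<Sum>K\<leftarrow>Ks. trace (mat_adjoint \<sigma> * (complex_of_real (q K) \<cdot>\<^sub>m S K)))"
    using C S by (subst trace_mult_msum[where m = m and n = n]) (auto simp: o_def)
  also have "\<dots> = (\<Sum>K\<leftarrow>Ks. of_real (q K) * trace (mat_adjoint \<sigma> * S K))"
    by (intro arg_cong[of _ _ sum_list] map_cong refl smult)
  finally have "Re (complex_of_real (frob \<sigma>)) = Re \<dots>" by simp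
  also have "Re (\<Sum>K\<leftarrow>Ks. of_real (q K) * trace (mat_adjoint \<sigma> * S K))
      = (\<Sum>K\<leftarrow>Ks. q K * Re (trace (mat_adjoint \<sigma> * S K)))"
    by (induction Ks) simp_all
  finally have inner: "(\<Sum>K\<leftarrow>Ks. q K * Re (trace (mat_adjoint \<sigma> * S K))) = frob \<sigma>" by simp
  \<comment> \<open>Since all norms agree, each distance expands to \<open>2 * frob \<sigma>\<close>
    minus twice a real inner product; the weighted mean of these is \<open>0\<close> by
    \<open>inner\<close>. Every distance with nonzero weight therefore vanishes.\<close>
  have "(\<Sum>K\<leftarrow>Ks. q K * frob (\<sigma> - S K))
      = (\<Sum>K\<leftarrow>Ks. 2 * frob \<sigma> * q K - 2 * (q K * Re (trace (mat_adjoint \<sigma> * S K))))"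
  proof (intro arg_cong[of _ _ sum_list] map_cong refl)
    fix K assume K: "K \<in> set Ks"
    show "q K * frob (\<sigma> - S K) = 2 * frob \<sigma> * q K - 2 * (q K * Re (trace (mat_adjoint \<sigma> * S K)))"
    proof -
      have eq: "frob (\<sigma> - S K) = 2 * frob \<sigma> - 2 * Re (trace (mat_adjoint \<sigma> * S K))"
        using frob_minus[OF C, of "S K"] S[OF K] by simp
      show ?thesis unfolding eq by (simp add: algebra_simps)
    qed
  qed
  also have "\<dots> = 2 * frob \<sigma> * (\<Sum>K\<leftarrow>Ks. q K) - 2 * (\<Sum>K\<leftarrow>Ks. q K * Re (trace (mat_adjoint \<sigma> * S K)))"
    by (simp add: sum_list_subtractf sum_list_const_mult)
  also have "\<dots> = 0" unfolding q(2) inner by simp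
  finally have zero: "(\<Sum>K\<leftarrow>Ks. q K * frob (\<sigma> - S K)) = 0" .
  have "\<exists>K\<in>set Ks. q K \<noteq> 0"
  proof (rule ccontr)
    assume "\<not> ?thesis"
    then have "(\<Sum>K\<leftarrow>Ks. q K) = (\<Sum>K\<leftarrow>Ks. 0)" by (intro arg_cong[of _ _ sum_list] map_cong) auto
    then show False using q(2) by simp
  qed
  then obtain K where K: "K \<in> set Ks" "q K \<noteq> 0" by blast
  have "q K * frob (\<sigma> - S K) = 0"
  proof -
    let ?xs = "map (\<lambda>K. q K * frob (\<sigma> - S K)) Ks"
    have "\<forall>x\<in>set ?xs. x = 0"
      using zero q(1) by (subst sum_list_nonneg_eq_0_iff[symmetric]) auto
    then show ?thesis using K(1) by simp
  qed
  then have "frob (\<sigma> - S K) = 0" using K by simp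
  then have Z: "\<sigma> - S K = 0\<^sub>m m n"
    by (rule frob_eq_0D) (use C S[OF K(1)] in auto)
  have "S K = \<sigma>"
  proof (rule eq_matI)
    fix i j assume ij: "i < dim_row \<sigma>" "j < dim_col \<sigma>"
    have "(\<sigma> - S K) $$ (i, j) = 0" unfolding Z using ij C by simp
    then show "S K $$ (i, j) = \<sigma> $$ (i, j)" using ij C S[OF K(1)] by auto
  qed (use C S[OF K(1)] in auto)
  with K(1) show ?thesis by blast
qed

section \<open>Values of the measure under Kraus operators\<close>

lemma SL_invariant_measureD:
  assumes "SL_invariant_measure ds E"
  shows "g \<in> SL_tensors ds \<Longrightarrow> \<rho> \<in> carrier_mat (prod_list ds) (prod_list ds) \<Longrightarrow>
      E (g * \<rho> * mat_adjoint g) = E \<rho>"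
    and "0 \<le> r \<Longrightarrow> \<rho> \<in> carrier_mat (prod_list ds) (prod_list ds) \<Longrightarrow>
      E (complex_of_real r \<cdot>\<^sub>m \<rho>) = r * E \<rho>"
    and "density_mat (prod_list ds) \<rho> \<Longrightarrow>
      \<exists>xs. pure_decomposition (prod_list ds) \<rho> xs \<and> E \<rho> = average_value E xs"
    and "density_mat (prod_list ds) \<rho> \<Longrightarrow> pure_decomposition (prod_list ds) \<rho> xs \<Longrightarrow>
      E \<rho> \<le> average_value E xs"
  using assms unfolding SL_invariant_measure_def Let_def by blast+

text \<open>A singular tensor factor can be doubled by an SL matrix, whence
  \<open>E (T * \<rho> * mat_adjoint T) = 4 * E (T * \<rho> * mat_adjoint T) = 0\<close> without any continuity of \<open>E\<close>.\<close>

lemma measure_kraus: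
  assumes E: "SL_invariant_measure ds E" and pos: "\<forall>i<length ds. 0 < ds ! i"
    and K: "kraus_list ds ds K" and \<rho>: "\<rho> \<in> carrier_mat (prod_list ds) (prod_list ds)"
  shows "E (tensor K * \<rho> * mat_adjoint (tensor K)) = (\<Prod>i<length ds. det_scale (K ! i)) * E \<rho>"
proof -
  let ?n = "length ds" and ?D = "prod_list ds"
  have len: "length K = ?n" and Kc: "\<And>i. i < ?n \<Longrightarrow> K ! i \<in> carrier_mat (ds ! i) (ds ! i)"
    using K by (auto simp: kraus_list_def)
  have T: "tensor K \<in> carrier_mat ?D ?D" by (rule tensor_carrier[OF len Kc])
  have SR: "M * \<rho> * mat_adjoint M \<in> carrier_mat ?D ?D" if "M \<in> carrier_mat ?D ?D" for M
    using that \<rho> by (intro mult_carrier_mat[of _ _ ?D]) auto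
  show ?thesis
  proof (cases "\<exists>i<?n. det (K ! i) = 0")
    case False
    \<comment> \<open>If all factors are nonsingular, the whole tensor product is a scalar multiple
      of an element of the group.\<close>
    have "\<exists>z g. g \<in> carrier_mat (ds ! i) (ds ! i) \<and> det g = 1 \<and> K ! i = z \<cdot>\<^sub>m g \<and> (cmod z)\<^sup>2 = det_scale (K ! i)"
      if "i < ?n" for i
      using nonsingular_eq_smult_SL[OF Kc[OF that]] pos False that by metis
    then obtain z g where zg: "\<And>i. i < ?n \<Longrightarrow> g i \<in> carrier_mat (ds ! i) (ds ! i) \<and> det (g i) = 1 \<and>
        K ! i = z i \<cdot>\<^sub>m g i \<and> (cmod (z i))\<^sup>2 = det_scale (K ! i)" by metis
    let ?G = "map g [0..<?n]"
    have G: "tensor ?G \<in> SL_tensors ds" unfolding SL_tensors_def using zg by (intro CollectI exI[of _ ?G]) auto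
    have Gc: "tensor ?G \<in> carrier_mat ?D ?D" by (rule tensor_carrier) (use zg in auto)
    have TG: "tensor K = (\<Prod>i<?n. z i) \<cdot>\<^sub>m tensor ?G"
      using tensor_smult[of K ?G z] len zg by simp
    have "(cmod (\<Prod>i<?n. z i))\<^sup>2 = (\<Prod>i<?n. det_scale (K ! i))"
      using zg by (simp add: prod_norm[symmetric] prod_power_distrib)
    moreover have "E (tensor K * \<rho> * mat_adjoint (tensor K))
        = (cmod (\<Prod>i<?n. z i))\<^sup>2 * E (tensor ?G * \<rho> * mat_adjoint (tensor ?G))"
      unfolding TG smult_sandwich[OF Gc \<rho>]
      by (rule SL_invariant_measureD(2)[OF E _ SR[OF Gc]]) simp
    ultimately show ?thesis using SL_invariant_measureD(1)[OF E G \<rho>] by simp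
  next
    case True
    then obtain i where i: "i < ?n" "det (K ! i) = 0" by blast
    obtain g where g: "g \<in> carrier_mat (ds ! i) (ds ! i)" "det g = 1" "g * K ! i = 2 \<cdot>\<^sub>m K ! i"
      by (rule singular_SL_double[OF Kc[OF i(1)] i(2)])
    \<comment> \<open>Only the party with the singular factor acts; doubling that factor doubles the
      whole tensor product.\<close>
    define G where "G = (map 1\<^sub>m ds)[i := g]"
    have lenG: "length G = ?n" by (simp add: G_def)
    have Gk: "G ! k = (if k = i then g else 1\<^sub>m (ds ! k))" if "k < ?n" for k
      using that by (simp add: G_def)
    have Gkc: "G ! k \<in> carrier_mat (ds ! k) (ds ! k) \<and> det (G ! k) = 1" if "k < ?n" for k
      using g Gk[OF that] by (auto simp: det_one)
    have G: "tensor G \<in> SL_tensors ds" unfolding SL_tensors_def using lenG Gkc by blast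
    have Gc: "tensor G \<in> carrier_mat ?D ?D" by (rule tensor_carrier[OF lenG]) (use Gkc in blast)
    have "tensor G * tensor K = tensor (map2 (*) G K)"
    proof (rule tensor_mult)
      fix k assume "k < length G"
      then have k: "k < ?n" using lenG by simp
      show "dim_col (G ! k) = dim_row (K ! k)" using Gkc[OF k] Kc[OF k] by auto
    qed (simp add: len lenG)
    also have "\<dots> = (\<Prod>k<length K. if k = i then 2 else 1) \<cdot>\<^sub>m tensor K"
    proof (rule tensor_smult)
      fix k assume "k < length K"
      then have k: "k < ?n" using len by simp
      have "1\<^sub>m (ds ! k) * K ! k = 1 \<cdot>\<^sub>m K ! k" using Kc[OF k] by auto
      then show "map2 (*) G K ! k = (if k = i then 2 else 1) \<cdot>\<^sub>m K ! k"
        using k len lenG Gk[OF k] g(3) by simp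
    qed (simp add: len lenG)
    also have "(\<Prod>k<length K. if k = i then 2 else 1 :: complex) = 2" using i len by simp
    finally have GK: "tensor G * tensor K = 2 \<cdot>\<^sub>m tensor K" .
    let ?X = "tensor K * \<rho> * mat_adjoint (tensor K)"
    have "E ?X = E (tensor G * ?X * mat_adjoint (tensor G))"
      by (rule SL_invariant_measureD(1)[OF E G SR[OF T], symmetric])
    \<comment> \<open>The factor \<open>2\<close> occurs once on each side of \<open>\<rho>\<close>,
      hence \<open>4\<close>.\<close>
    also have "tensor G * ?X * mat_adjoint (tensor G) = complex_of_real 4 \<cdot>\<^sub>m ?X"
      using sandwich_mult[OF Gc T \<rho>] smult_sandwich[OF T \<rho>, of 2] unfolding GK by simp
    also have "E \<dots> = 4 * E ?X" by (rule SL_invariant_measureD(2)[OF E _ SR[OF T]]) simp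
    finally have "E ?X = 0" by simp
    moreover have "det_scale (K ! i) = 0" using i by (simp add: det_scale_def)
    ultimately show ?thesis using i by auto
  qed
qed

lemma prod_list_pos: "\<forall>i<length ds. 0 < ds ! i \<Longrightarrow> 0 < prod_list (ds :: nat list)"
proof (induction ds)
  case (Cons d ds)
  have "0 < d" using Cons.prems by (metis length_greater_0_conv list.discI nth_Cons_0)
  moreover have "\<forall>i<length ds. 0 < ds ! i" using Cons.prems by (metis Suc_less_eq length_Cons nth_Cons_Suc)
  ultimately show ?case using Cons.IH by simp
qed simp

lemma msum_concat:
  assumes "\<forall>As\<in>set Ass. \<forall>A\<in>set As. A \<in> carrier_mat m n"
  shows "msum m n (concat Ass) = msum m n (map (msum m n) Ass)"
  using assms by (induction Ass) (simp_all add: msum_append)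

text \<open>The upper bound of the convex roof without normalization: the weight of each term is
  hidden in the length of the vector, and homogeneity of \<open>E\<close> absorbs it. Images of unit
  vectors under Kraus operators come in this form.\<close>

lemma measure_msum_ket_bra_le:
  assumes E: "SL_invariant_measure ds E" and pos: "\<forall>i<length ds. 0 < ds ! i"
    and \<sigma>: "density_mat (prod_list ds) (msum (prod_list ds) (prod_list ds) (map ket_bra \<phi>s))"
    and \<phi>s: "\<forall>\<phi>\<in>set \<phi>s. \<phi> \<in> carrier_vec (prod_list ds)"
  shows "E (msum (prod_list ds) (prod_list ds) (map ket_bra \<phi>s)) \<le> (\<Sum>\<phi>\<leftarrow>\<phi>s. E (ket_bra \<phi>))"
proof -
  let ?D = "prod_list ds"
  \<comment> \<open>Squared norm as weight, together with the normalized vector. The zero vector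
    cannot be normalized; it receives weight \<open>0\<close> and a basis vector, which exists since
    \<open>?D\<close> is positive.\<close>
  define f where "f \<phi> = (if \<phi> = 0\<^sub>v ?D then (0, unit_vec ?D 0)
      else (Re (\<phi> \<bullet>c \<phi>), complex_of_real (1 / sqrt (Re (\<phi> \<bullet>c \<phi>))) \<cdot>\<^sub>v \<phi>))" for \<phi> :: "complex vec"
  have D: "0 < ?D" by (rule prod_list_pos[OF pos])
  have f: "case f \<phi> of (p, \<psi>) \<Rightarrow> 0 \<le> p \<and> \<psi> \<in> carrier_vec ?D \<and> \<psi> \<bullet>c \<psi> = 1 \<and>
      complex_of_real p \<cdot>\<^sub>m ket_bra \<psi> = ket_bra \<phi>" if \<phi>: "\<phi> \<in> carrier_vec ?D" for \<phi>
  proof (cases "\<phi> = 0\<^sub>v ?D")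
    case True
    have "unit_vec ?D 0 \<bullet>c unit_vec ?D 0 = (1 :: complex)"
      using D by (subst scalar_prod_left_unit[where n = ?D]) auto
    moreover have "0 \<cdot>\<^sub>m ket_bra (unit_vec ?D 0) = ket_bra (0\<^sub>v ?D)"
      by (rule eq_matI) (auto simp: ket_bra_def)
    ultimately show ?thesis unfolding f_def True by simp
  next
    case False
    define r where "r = Re (\<phi> \<bullet>c \<phi>)"
    have "0 < \<phi> \<bullet>c \<phi>" using False \<phi> by (simp add: conjugate_square_greater_0_vec)
    then have r: "0 < r" "\<phi> \<bullet>c \<phi> = of_real r"
      by (auto simp: r_def less_complex_def complex_eq_iff)
    define c where "c = complex_of_real (1 / sqrt r)"
    have c2: "(cmod c)\<^sup>2 = 1 / r" using r by (simp add: c_def power_divide norm_divide)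
    have "(c \<cdot>\<^sub>v \<phi>) \<bullet>c (c \<cdot>\<^sub>v \<phi>) = c * cnj c * (\<phi> \<bullet>c \<phi>)"
      using \<phi> by (simp add: scalar_prod_def sum_distrib_left mult_ac)
    also have "\<dots> = 1" unfolding complex_norm_square[symmetric] c2 r(2) using r(1) by simp
    finally have "(c \<cdot>\<^sub>v \<phi>) \<bullet>c (c \<cdot>\<^sub>v \<phi>) = 1" .
    moreover have "complex_of_real r \<cdot>\<^sub>m ket_bra (c \<cdot>\<^sub>v \<phi>) = ket_bra \<phi>"
      unfolding ket_bra_smult c2 using r(1) by (intro eq_matI) auto
    ultimately show ?thesis using False \<phi> r(1) unfolding f_def by (simp add: r_def c_def)
  qed
  have "pure_decomposition ?D (msum ?D ?D (map ket_bra \<phi>s)) (map f \<phi>s)"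
    unfolding pure_decomposition_def
  proof (intro conjI)
    show "\<forall>(p, \<psi>)\<in>set (map f \<phi>s). 0 \<le> p \<and> \<psi> \<in> carrier_vec ?D \<and> \<psi> \<bullet>c \<psi> = 1"
    proof (intro ballI)
      fix x assume "x \<in> set (map f \<phi>s)"
      then obtain \<phi> where "\<phi> \<in> set \<phi>s" "x = f \<phi>" by auto
      then show "case x of (p, \<psi>) \<Rightarrow> 0 \<le> p \<and> \<psi> \<in> carrier_vec ?D \<and> \<psi> \<bullet>c \<psi> = 1"
        using f[of \<phi>] \<phi>s by (auto split: prod.splits)
    qed
    have "map ket_bra \<phi>s = map (\<lambda>(p, \<psi>). complex_of_real p \<cdot>\<^sub>m ket_bra \<psi>) (map f \<phi>s)"
      unfolding map_map
    proof (rule map_cong[OF refl])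
      fix \<phi> assume "\<phi> \<in> set \<phi>s"
      then show "ket_bra \<phi> = ((\<lambda>(p, \<psi>). complex_of_real p \<cdot>\<^sub>m ket_bra \<psi>) \<circ> f) \<phi>"
        using f[of \<phi>] \<phi>s by (auto split: prod.splits)
    qed
    then show "msum ?D ?D (map ket_bra \<phi>s)
        = msum ?D ?D (map (\<lambda>(p, \<psi>). complex_of_real p \<cdot>\<^sub>m ket_bra \<psi>) (map f \<phi>s))" by (rule arg_cong)
  qed
  then have "E (msum ?D ?D (map ket_bra \<phi>s)) \<le> average_value E (map f \<phi>s)"
    by (rule SL_invariant_measureD(4)[OF E \<sigma>])
  also have "average_value E (map f \<phi>s) = (\<Sum>\<phi>\<leftarrow>\<phi>s. E (ket_bra \<phi>))"
    unfolding average_value_def map_map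
  proof (intro arg_cong[of _ _ sum_list] map_cong refl)
    fix \<phi> assume "\<phi> \<in> set \<phi>s"
    then have \<phi>: "\<phi> \<in> carrier_vec ?D" using \<phi>s by blast
    obtain p \<psi> where p: "f \<phi> = (p, \<psi>)" by fastforce
    have "0 \<le> p" "\<psi> \<in> carrier_vec ?D" "complex_of_real p \<cdot>\<^sub>m ket_bra \<psi> = ket_bra \<phi>"
      using f[OF \<phi>] unfolding p by auto
    then show "((\<lambda>(p, \<psi>). p * E (ket_bra \<psi>)) \<circ> f) \<phi> = E (ket_bra \<phi>)"
      using SL_invariant_measureD(2)[OF E, of p "ket_bra \<psi>"] p by simp
  qed
  finally show ?thesis .
qed

text \<open>An optimal decomposition of \<open>\<rho>\<close>, pushed through all Kraus operators,
  is a decomposition of \<open>\<sigma>\<close>. It need not be optimal there, whence an inequality.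
  Each Kraus operator scales every term by the same factor, so the average over the decomposition
  reassembles to \<open>E \<rho>\<close>.\<close>

lemma measure_kraus_sum_le:
  assumes E: "SL_invariant_measure ds E" and pos: "\<forall>i<length ds. 0 < ds ! i"
    and Ks: "\<forall>K\<in>set Ks. kraus_list ds ds K" and \<rho>: "density_mat (prod_list ds) \<rho>"
    and \<sigma>: "\<sigma> = msum (prod_list ds) (prod_list ds)
      (map (\<lambda>K. tensor K * \<rho> * mat_adjoint (tensor K)) Ks)" "density_mat (prod_list ds) \<sigma>"
  shows "E \<sigma> \<le> (\<Sum>K\<leftarrow>Ks. \<Prod>i<length ds. det_scale (K ! i)) * E \<rho>"
proof -
  let ?D = "prod_list ds"
  obtain xs where xs: "pure_decomposition ?D \<rho> xs" and avg: "E \<rho> = average_value E xs"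
    using SL_invariant_measureD(3)[OF E \<rho>] by blast
  have xsD: "0 \<le> p" "\<psi> \<in> carrier_vec ?D" if "(p, \<psi>) \<in> set xs" for p \<psi>
    using xs that unfolding pure_decomposition_def by blast+
  have \<rho>_eq: "\<rho> = msum ?D ?D (map (\<lambda>(p, \<psi>). complex_of_real p \<cdot>\<^sub>m ket_bra \<psi>) xs)"
    using xs unfolding pure_decomposition_def by blast
  have T: "tensor K \<in> carrier_mat ?D ?D" if "K \<in> set Ks" for K
    using Ks that by (intro tensor_carrier) (auto simp: kraus_list_def)
  \<comment> \<open>The square root appears because \<open>ket_bra\<close> is quadratic: the
    rank-one operator of the vector carries the weight \<open>p\<close> itself.\<close>
  define v where "v K = (\<lambda>(p, \<psi>). complex_of_real (sqrt p) \<cdot>\<^sub>v (tensor K *\<^sub>v \<psi>))" for K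
  have v: "v K (p, \<psi>) \<in> carrier_vec ?D"
    "ket_bra (v K (p, \<psi>)) = tensor K * (complex_of_real p \<cdot>\<^sub>m ket_bra \<psi>) * mat_adjoint (tensor K)"
    "E (ket_bra (v K (p, \<psi>))) = (\<Prod>i<length ds. det_scale (K ! i)) * (p * E (ket_bra \<psi>))"
    if K: "K \<in> set Ks" and p: "(p, \<psi>) \<in> set xs" for K p \<psi>
  proof -
    note p0 = xsD(1)[OF p] and \<psi> = xsD(2)[OF p] and TK = T[OF K]
    show c: "v K (p, \<psi>) \<in> carrier_vec ?D"
      using mult_mat_vec_carrier[OF TK \<psi>] by (simp add: v_def)
    have kb: "ket_bra \<psi> \<in> carrier_mat ?D ?D" using \<psi> by simp
    have "ket_bra (v K (p, \<psi>)) = complex_of_real p \<cdot>\<^sub>m (tensor K * ket_bra \<psi> * mat_adjoint (tensor K))"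
      using p0 by (simp add: v_def ket_bra_smult ket_bra_mult_mat_vec[OF TK \<psi>])
    also have "\<dots> = complex_of_real p \<cdot>\<^sub>m (tensor K * ket_bra \<psi>) * mat_adjoint (tensor K)"
      by (rule mult_smult_assoc_mat[symmetric, where nr = ?D and n = ?D and nc = ?D]) (use TK kb in auto)
    also have "complex_of_real p \<cdot>\<^sub>m (tensor K * ket_bra \<psi>) = tensor K * (complex_of_real p \<cdot>\<^sub>m ket_bra \<psi>)"
      by (rule mult_smult_distrib[symmetric, OF TK kb])
    finally show eq: "ket_bra (v K (p, \<psi>)) = tensor K * (complex_of_real p \<cdot>\<^sub>m ket_bra \<psi>) * mat_adjoint (tensor K)" .
    have "E (ket_bra (v K (p, \<psi>))) = (\<Prod>i<length ds. det_scale (K ! i)) * E (complex_of_real p \<cdot>\<^sub>m ket_bra \<psi>)"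
      unfolding eq using Ks K kb by (intro measure_kraus[OF E pos]) auto
    then show "E (ket_bra (v K (p, \<psi>))) = (\<Prod>i<length ds. det_scale (K ! i)) * (p * E (ket_bra \<psi>))"
      using SL_invariant_measureD(2)[OF E p0 kb] by simp
  qed
  define \<phi>s where "\<phi>s = concat (map (\<lambda>K. map (v K) xs) Ks)"
  have \<phi>s: "\<forall>\<phi>\<in>set \<phi>s. \<phi> \<in> carrier_vec ?D" unfolding \<phi>s_def using v(1) by fastforce
  have \<sigma>_eq: "\<sigma> = msum ?D ?D (map ket_bra \<phi>s)"
  proof -
    have "msum ?D ?D (map ket_bra \<phi>s) = msum ?D ?D (map (\<lambda>K. msum ?D ?D (map (\<lambda>x. ket_bra (v K x)) xs)) Ks)"
      unfolding \<phi>s_def map_concat using v(1) by (subst msum_concat) (fastforce simp: o_def)+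
    also have "map (\<lambda>K. msum ?D ?D (map (\<lambda>x. ket_bra (v K x)) xs)) Ks
        = map (\<lambda>K. tensor K * \<rho> * mat_adjoint (tensor K)) Ks"
    proof (rule map_cong[OF refl])
      fix K assume K: "K \<in> set Ks"
      have "tensor K * \<rho> * mat_adjoint (tensor K) = msum ?D ?D
          (map (\<lambda>A. tensor K * A * mat_adjoint (tensor K)) (map (\<lambda>(p, \<psi>). complex_of_real p \<cdot>\<^sub>m ket_bra \<psi>) xs))"
        unfolding \<rho>_eq by (rule mult_msum[OF T[OF K] mat_adjoint_carrier[OF T[OF K]]]) (use xsD in auto)
      also have "(map (\<lambda>A. tensor K * A * mat_adjoint (tensor K)) (map (\<lambda>(p, \<psi>). complex_of_real p \<cdot>\<^sub>m ket_bra \<psi>) xs))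
          = map (\<lambda>x. ket_bra (v K x)) xs"
        using v(2)[OF K] by auto
      finally show "msum ?D ?D (map (\<lambda>x. ket_bra (v K x)) xs) = tensor K * \<rho> * mat_adjoint (tensor K)" ..
    qed
    finally show ?thesis using \<sigma>(1) by simp
  qed
  have "E \<sigma> \<le> (\<Sum>\<phi>\<leftarrow>\<phi>s. E (ket_bra \<phi>))"
    using \<sigma>(2) unfolding \<sigma>_eq by (rule measure_msum_ket_bra_le[OF E pos _ \<phi>s])
  also have "\<dots> = (\<Sum>K\<leftarrow>Ks. \<Sum>x\<leftarrow>xs. E (ket_bra (v K x)))"
    unfolding \<phi>s_def by (induction Ks) (simp_all add: o_def)
  also have "\<dots> = (\<Sum>K\<leftarrow>Ks. (\<Prod>i<length ds. det_scale (K ! i)) * E \<rho>)"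
  proof (intro arg_cong[of _ _ sum_list] map_cong refl)
    fix K assume K: "K \<in> set Ks"
    have "(\<Sum>x\<leftarrow>xs. E (ket_bra (v K x)))
        = (\<Sum>(p, \<psi>)\<leftarrow>xs. (\<Prod>i<length ds. det_scale (K ! i)) * (p * E (ket_bra \<psi>)))"
      using v(3)[OF K] by (intro arg_cong[of _ _ sum_list] map_cong refl) auto
    also have "\<dots> = (\<Prod>i<length ds. det_scale (K ! i)) * E \<rho>"
      unfolding avg average_value_def by (simp add: sum_list_const_mult[symmetric] split_def)
    finally show "(\<Sum>x\<leftarrow>xs. E (ket_bra (v K x))) = (\<Prod>i<length ds. det_scale (K ! i)) * E \<rho>" .
  qed
  also have "\<dots> = (\<Sum>K\<leftarrow>Ks. \<Prod>i<length ds. det_scale (K ! i)) * E \<rho>"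
    by (rule sum_list_mult_const)
  finally show ?thesis .
qed

section \<open>Extremal Kraus operators\<close>

text \<open>One strict inequality between factors would make the products differ strictly.
  Positivity is essential here: a vanishing factor would hide it.\<close>

lemma prod_eq_imp_eq:
  fixes f g :: "'a \<Rightarrow> 'b :: linordered_field"
  assumes I: "finite I" and fg: "\<And>i. i \<in> I \<Longrightarrow> 0 < f i \<and> f i \<le> g i"
    and eq: "prod f I = prod g I" and i: "i \<in> I"
  shows "f i = g i"
proof (rule ccontr)
  assume "f i \<noteq> g i"
  then have lt: "f i < g i" using fg[OF i] by simp
  have "prod f (I - {i}) \<le> prod g (I - {i})" using fg by (intro prod_mono) (auto simp: less_imp_le)
  moreover have "0 < prod f (I - {i})" using fg by (intro prod_pos) auto
  ultimately have "f i * prod f (I - {i}) < g i * prod g (I - {i})"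
    using lt fg[OF i] by (intro mult_less_le_imp_less) auto
  then show False using eq prod.remove[OF I i, of f] prod.remove[OF I i, of g] by simp
qed

lemma sum_list_eq_imp_eq:
  fixes f g :: "'a \<Rightarrow> 'b :: linordered_idom"
  assumes "\<And>x. x \<in> set xs \<Longrightarrow> f x \<le> g x" "(\<Sum>x\<leftarrow>xs. g x) \<le> (\<Sum>x\<leftarrow>xs. f x)" "x \<in> set xs"
  shows "f x = g x"
  using assms
proof (induction xs)
  case (Cons y ys)
  have "(\<Sum>x\<leftarrow>ys. f x) \<le> (\<Sum>x\<leftarrow>ys. g x)" "f y \<le> g y" using Cons.prems by (auto intro: sum_list_mono)
  then have "f y = g y" "(\<Sum>x\<leftarrow>ys. g x) \<le> (\<Sum>x\<leftarrow>ys. f x)" using Cons.prems(2) by auto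
  with Cons show ?case by auto
qed simp

text \<open>Division by \<open>sqrt c\<close> gives an isometry, and for a square matrix a left
  inverse is also a right inverse.\<close>

lemma scaled_unitary:
  assumes A: "A \<in> carrier_mat n n" and c: "0 < c"
    and AA: "mat_adjoint A * A = complex_of_real c \<cdot>\<^sub>m 1\<^sub>m n"
  obtains U where "unitary_mat n U" "A = complex_of_real (sqrt c) \<cdot>\<^sub>m U"
proof -
  define U where "U = complex_of_real (1 / sqrt c) \<cdot>\<^sub>m A"
  have U: "U \<in> carrier_mat n n" using A by (simp add: U_def)
  have "mat_adjoint U * U = complex_of_real (1 / sqrt c) \<cdot>\<^sub>m (mat_adjoint A * (complex_of_real (1 / sqrt c) \<cdot>\<^sub>m A))"
    unfolding U_def mat_adjoint_smult complex_cnj_complex_of_real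
    by (rule mult_smult_assoc_mat[where nr = n and n = n and nc = n]) (use A in auto)
  also have "\<dots> = complex_of_real (1 / sqrt c) \<cdot>\<^sub>m (complex_of_real (1 / sqrt c) \<cdot>\<^sub>m (mat_adjoint A * A))"
    unfolding mult_smult_distrib[OF mat_adjoint_carrier[OF A] A] ..
  also have "\<dots> = 1\<^sub>m n"
  proof -
    have "1 / sqrt c * (1 / sqrt c * c) = 1" using c by (simp add: divide_simps)
    then have "complex_of_real (1 / sqrt c) * (complex_of_real (1 / sqrt c) * complex_of_real c) = 1"
      unfolding of_real_mult[symmetric] by (simp only: of_real_1)
    then show ?thesis unfolding AA by (intro eq_matI) auto
  qed
  finally have UU: "mat_adjoint U * U = 1\<^sub>m n" .
  then have "U * mat_adjoint U = 1\<^sub>m n"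
    using mat_mult_left_right_inverse[OF mat_adjoint_carrier[OF U] U] by simp
  then have "unitary_mat n U" using U UU by (simp add: unitary_mat_def)
  moreover have "A = complex_of_real (sqrt c) \<cdot>\<^sub>m U"
    unfolding U_def using c by (intro eq_matI) auto
  ultimately show thesis by (rule that)
qed

text \<open>When no factor vanishes, equality of the two products passes to each factor, where the
  equality case of the mean inequality applies. A vanishing factor makes both products
  \<open>0\<close> and says nothing about the others, but then the whole Kraus operator is
  \<open>0\<close>.\<close>

lemma kraus_extremal_unitary:
  assumes pos: "\<forall>i<length ds. 0 < ds ! i" and K: "kraus_list ds ds K"
    and eq: "(\<Prod>i<length ds. det_scale (K ! i)) = (\<Prod>i<length ds. frob (K ! i) / ds ! i)"
  shows "\<exists>Us c. length Us = length ds \<and> (\<forall>i<length ds. unitary_mat (ds ! i) (Us ! i)) \<and>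
    tensor K = c \<cdot>\<^sub>m tensor Us \<and> (cmod c)\<^sup>2 = (\<Prod>i<length ds. det_scale (K ! i))"
proof -
  let ?n = "length ds"
  have len: "length K = ?n" and Kc: "\<And>i. i < ?n \<Longrightarrow> K ! i \<in> carrier_mat (ds ! i) (ds ! i)"
    using K by (auto simp: kraus_list_def)
  show ?thesis
  proof (cases "\<exists>i<?n. frob (K ! i) = 0")
    case True
    then obtain i where i: "i < ?n" "frob (K ! i) = 0" by blast
    have Ki: "K ! i = 0\<^sub>m (ds ! i) (ds ! i)" by (rule frob_eq_0D[OF i(2) Kc[OF i(1)]])
    \<comment> \<open>Placeholder unitaries: with \<open>c = 0\<close> any choice represents the
      zero operator.\<close>
    let ?Us = "map 1\<^sub>m ds :: complex mat list"
    have "tensor K = (\<Prod>k<length K. if k = i then 0 else 1) \<cdot>\<^sub>m tensor K"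
    proof (rule tensor_smult)
      fix k assume "k < length K"
      then show "K ! k = (if k = i then 0 else 1) \<cdot>\<^sub>m K ! k" using Ki by (auto intro!: eq_matI)
    qed simp
    also have "(\<Prod>k<length K. if k = i then 0 else 1 :: complex) = 0" using i len by auto
    also have "0 \<cdot>\<^sub>m tensor K = 0 \<cdot>\<^sub>m tensor ?Us"
      unfolding tensor_one using map_dim_eq[OF len Kc] by (intro eq_matI) auto
    finally have "tensor K = 0 \<cdot>\<^sub>m tensor ?Us" .
    moreover have "(\<Prod>i<?n. det_scale (K ! i)) = 0" unfolding eq using i by auto
    ultimately show ?thesis by (intro exI[of _ ?Us] exI[of _ 0]) (auto simp: unitary_mat_def)
  next
    case False
    then have fpos: "0 < frob (K ! i)" if "i < ?n" for i
      using that frob_nonneg[of "K ! i"] by (metis less_le)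
    have ppos: "0 < (\<Prod>i<?n. frob (K ! i) / ds ! i)" using fpos pos by (intro prod_pos) auto
    have dpos: "0 < det_scale (K ! i)" if "i < ?n" for i
    proof -
      have "det_scale (K ! i) \<noteq> 0" using ppos that unfolding eq[symmetric] by (auto simp: less_le)
      then show ?thesis using det_scale_nonneg[of "K ! i"] by linarith
    qed
    have deq: "det_scale (K ! i) = frob (K ! i) / ds ! i" if "i < ?n" for i
    proof (rule prod_eq_imp_eq[where f = "\<lambda>i. det_scale (K ! i)" and g = "\<lambda>i. frob (K ! i) / ds ! i" and I = "{..<?n}"])
      show "0 < det_scale (K ! i) \<and> det_scale (K ! i) \<le> frob (K ! i) / ds ! i" if "i \<in> {..<?n}" for i
        using dpos det_scale_le_frob[OF Kc] pos that by auto
    qed (use eq that in auto)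
    have "\<exists>U. unitary_mat (ds ! i) U \<and> K ! i = complex_of_real (sqrt (det_scale (K ! i))) \<cdot>\<^sub>m U"
      if "i < ?n" for i
      using scaled_unitary[OF Kc[OF that] dpos[OF that] det_scale_eq_frobD[OF Kc[OF that] _ deq[OF that]]]
        pos that by metis
    then obtain U where U: "\<And>i. i < ?n \<Longrightarrow> unitary_mat (ds ! i) (U i) \<and>
        K ! i = complex_of_real (sqrt (det_scale (K ! i))) \<cdot>\<^sub>m U i" by metis
    let ?Us = "map U [0..<?n]"
    have "tensor K = (\<Prod>i<?n. complex_of_real (sqrt (det_scale (K ! i)))) \<cdot>\<^sub>m tensor ?Us"
      using tensor_smult[of K ?Us "\<lambda>i. complex_of_real (sqrt (det_scale (K ! i)))"] U len by auto
    moreover have "(cmod (\<Prod>i<?n. complex_of_real (sqrt (det_scale (K ! i)))))\<^sup>2 = (\<Prod>i<?n. det_scale (K ! i))"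
      by (simp add: prod_norm[symmetric] prod_power_distrib)
    ultimately show ?thesis using U by (intro exI[of _ ?Us] exI) auto
  qed
qed

theorem theorem6:
  fixes ds :: "nat list" and P :: "nat \<Rightarrow> nat"
    and E :: "complex mat \<Rightarrow> real" and \<rho> :: "complex mat"
  assumes "\<forall>i<length ds. 0 < ds ! i"
    and "P permutes {..<length ds}"
    and "\<forall>i<length ds. ds ! P i = ds ! i"
    and "SL_invariant_measure ds E"
    and "\<forall>\<sigma>\<in>carrier_mat (prod_list ds) (prod_list ds).
           E (perm_op ds P * \<sigma> * mat_adjoint (perm_op ds P)) = E \<sigma>"
    and "density_mat (prod_list ds) \<rho>"
    and "0 < E \<rho>"
    and "entanglement_P_symmetric ds P \<rho>"
  shows "\<exists>Us. length Us = length ds \<and>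
           (\<forall>i<length ds. unitary_mat (ds ! i) (Us ! i)) \<and>
           perm_op ds P * \<rho> * mat_adjoint (perm_op ds P) =
             tensor Us * \<rho> * mat_adjoint (tensor Us)"
proof -
  let ?n = "length ds" and ?D = "prod_list ds" and ?V = "perm_op ds P"
  define \<sigma> where "\<sigma> = ?V * \<rho> * mat_adjoint ?V"
  note pos = assms(1)
  have \<rho>: "\<rho> \<in> carrier_mat ?D ?D" using assms(6) by (simp add: density_mat_def)
  note V = perm_op_carrier[of ds P] and iso = perm_op_isometry[OF assms(2,3)]
  have dens: "density_mat ?D \<sigma>" unfolding \<sigma>_def by (rule density_mat_isometry[OF assms(6) V iso])
  have E\<sigma>: "E \<sigma> = E \<rho>" unfolding \<sigma>_def using assms(5) \<rho> by blast
  obtain Ks where Ks: "locc ds ds Ks"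
    and \<sigma>_eq: "\<sigma> = msum ?D ?D (map (\<lambda>K. tensor K * \<rho> * mat_adjoint (tensor K)) Ks)"
    using assms(8) \<rho> unfolding entanglement_P_symmetric_def locc_map_def \<sigma>_def by metis
  note kraus = locc_kraus_list[OF Ks]
  define q t where "q K = (\<Prod>i<?n. det_scale (K ! i))"
    and "t K = (\<Prod>i<?n. frob (K ! i) / ds ! i)" for K
  have le: "q K \<le> t K" if "K \<in> set Ks" for K
    unfolding q_def t_def using kraus that pos
    by (intro prod_mono) (auto simp: kraus_list_def intro!: det_scale_le_frob)
  have "(\<Sum>K\<leftarrow>Ks. t K) = (\<Sum>K\<leftarrow>Ks. \<Prod>i<?n. frob (K ! i)) / (\<Prod>i<?n. real (ds ! i))"
    unfolding t_def prod_dividef unfolding divide_inverse by (rule sum_list_mult_const)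
  also have "\<dots> = 1"
  proof -
    have "(\<Prod>i<?n. real (ds ! i)) \<noteq> 0" using pos by auto
    then show ?thesis unfolding locc_sum_frob[OF Ks] by simp
  qed
  finally have sum_t: "(\<Sum>K\<leftarrow>Ks. t K) = 1" .
  \<comment> \<open>Invariance of \<open>E\<close> under \<open>P\<close> puts the same value on
    both sides, so that positivity of \<open>E \<rho>\<close> allows its cancellation.\<close>
  have "E \<rho> \<le> (\<Sum>K\<leftarrow>Ks. q K) * E \<rho>"
    unfolding q_def using measure_kraus_sum_le[OF assms(4) pos kraus assms(6) \<sigma>_eq dens] E\<sigma> by simp
  then have "1 \<le> (\<Sum>K\<leftarrow>Ks. q K)" using assms(7) by simp
  \<comment> \<open>Termwise \<open>q K \<le> t K\<close>, while the \<open>q K\<close> sum to at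
    least \<open>1\<close> and the \<open>t K\<close> to exactly \<open>1\<close>: no term has any
    slack.\<close>
  then have qt: "q K = t K" if "K \<in> set Ks" for K
    using sum_list_eq_imp_eq[where f = q and g = t, OF le _ that] sum_t by simp
  have "(\<Sum>K\<leftarrow>Ks. q K) = (\<Sum>K\<leftarrow>Ks. t K)"
    using qt by (intro arg_cong[of _ _ sum_list] map_cong) auto
  then have sum_q: "(\<Sum>K\<leftarrow>Ks. q K) = 1" using sum_t by simp
  have "\<exists>Us c. length Us = ?n \<and> (\<forall>i<?n. unitary_mat (ds ! i) (Us ! i)) \<and>
      tensor K = c \<cdot>\<^sub>m tensor Us \<and> (cmod c)\<^sup>2 = q K" if "K \<in> set Ks" for K
    using kraus_extremal_unitary[OF pos, of K] kraus qt[OF that] that unfolding q_def t_def by blast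
  then obtain Us c where Us: "\<And>K. K \<in> set Ks \<Longrightarrow> length (Us K) = ?n \<and>
      (\<forall>i<?n. unitary_mat (ds ! i) (Us K ! i)) \<and>
      tensor K = c K \<cdot>\<^sub>m tensor (Us K) \<and> (cmod (c K))\<^sup>2 = q K" by metis
  define S where "S K = tensor (Us K) * \<rho> * mat_adjoint (tensor (Us K))" for K
  have W: "tensor (Us K) \<in> carrier_mat ?D ?D" if "K \<in> set Ks" for K
    using Us[OF that] by (intro tensor_carrier) (auto simp: unitary_mat_def)
  \<comment> \<open>Both \<open>S K\<close> and \<open>\<sigma>\<close> arise from
    \<open>\<rho>\<close> by conjugation with an isometry, so both have the norm of
    \<open>\<rho>\<close>.\<close>
  have S: "S K \<in> carrier_mat ?D ?D \<and> frob (S K) = frob \<sigma>" if "K \<in> set Ks" for K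
  proof
    show "S K \<in> carrier_mat ?D ?D" unfolding S_def
      using W[OF that] \<rho> by (intro mult_carrier_mat[of _ _ ?D]) auto
    have "mat_adjoint (tensor (Us K)) * tensor (Us K) = 1\<^sub>m ?D"
      by (rule tensor_isometry) (use Us[OF that] in auto)
    then show "frob (S K) = frob \<sigma>"
      unfolding S_def \<sigma>_def frob_isometry_sandwich[OF V \<rho> iso] by (rule frob_isometry_sandwich[OF W[OF that] \<rho>])
  qed
  have "map (\<lambda>K. tensor K * \<rho> * mat_adjoint (tensor K)) Ks = map (\<lambda>K. complex_of_real (q K) \<cdot>\<^sub>m S K) Ks"
  proof (rule map_cong[OF refl])
    fix K assume K: "K \<in> set Ks"
    then show "tensor K * \<rho> * mat_adjoint (tensor K) = complex_of_real (q K) \<cdot>\<^sub>m S K"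
      using smult_sandwich[OF W[OF K] \<rho>, of "c K"] Us[OF K] by (simp add: S_def)
  qed
  then have "\<sigma> = msum ?D ?D (map (\<lambda>K. complex_of_real (q K) \<cdot>\<^sub>m S K) Ks)"
    unfolding \<sigma>_eq by (rule arg_cong)
  moreover have "0 \<le> q K" for K unfolding q_def by (intro prod_nonneg) simp
  ultimately have "\<exists>K\<in>set Ks. S K = \<sigma>"
    by (intro convex_combination_equal_frob[where S = S and q = q, OF S _ sum_q])
  then obtain K where K: "K \<in> set Ks" "S K = \<sigma>" by blast
  show ?thesis
    using Us[OF K(1)] K(2) unfolding S_def \<sigma>_def by (intro exI[of _ "Us K"]) simp
qed

end
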